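(* Let $r\geq 1$, $k\geq 1$, $0\leq q<k$, $a<b$, and positive constants $D_0,\dots,D_r$ be given, and let $u_a^0,\dots,u_a^{k-1}\in\mathbb{R}$ be fixed initial values. Consider the class $\mathcal{G}^r$ and the initial-value problem (IVP) described in the context. Then there exist constants $C>0$ and $\varepsilon_0>0$, depending only on the class $\mathcal{G}^r$ (i.e. on $a,b,r,q,D_0,\dots,D_r$) and on $k$, such that for all $\varepsilon\in(0,\varepsilon_0)$: $$\mathrm{comp}^{\mathrm{rand}}(\mathcal{G}^r,\varepsilon)\geq C\left(\frac{1}{\varepsilon}\right)^{1/(r+1/2)}\quad\text{and}\quad \mathrm{comp}^{\mathrm{quant}}(\mathcal{G}^r,\varepsilon)\geq C\left(\frac{1}{\varepsilon}\right)^{1/(r+1)}.$$ In other words, $\mathrm{comp}^{\mathrm{rand}}(\mathcal{G}^r,\varepsilon)=\Omega\big((1/\varepsilon)^{1/(r+1/2)}\big)$ and $\mathrm{comp}^{\mathrm{quant}}(\mathcal{G}^r,\varepsilon)=\Omega\big((1/\varepsilon)^{1/(r+1)}\big)$, for every $k$.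
   Context: The initial-value problem (IVP) is $$u^{(k)}(x)=g\big(x,u(x),u'(x),\dots,u^{(q)}(x)\big),\quad x\in[a,b],\qquad u^{(j)}(a)=u_a^j,\ j=0,\dots,k-1,$$ with $g:[a,b]\times\mathbb{R}^{q+1}\to\mathbb{R}$. The class of right-hand sides is $$\mathcal{G}^r=\{g\in C^{(r)}([a,b]\times\mathbb{R}^{q+1}) : |\partial^j g(x,y)|\leq D_j \text{ for all } x\in[a,b],\ y\in\mathbb{R}^{q+1},\ j=0,\dots,r\},$$ where $\partial^j g$ denotes any partial derivative of order $j$ of $g$. An algorithm produces an approximation $l$ (random in the randomized and quantum settings, written $l^\omega$ with $\omega$ from a probability space) to the solution $u$ on $[a,b]$, using information about $g$. The error at $g$ is $e^\omega(A,g)=\sup_{x\in[a,b]}|u(x)-l^\omega(x)|$. - Randomized setting: information consists of values of $g$ or its partial derivatives at randomly chosen points; the error is $e^{\mathrm{rand}}(A,\mathcal{G}^r)=\sup_{g\in\mathcal{G}^r}(\mathbf{E}\,e^\omega(A,g)^2)^{1/2}$; the cost is the number of evaluations of $g$ or its partial derivatives. - Quantum setting: information is obtained by calls of a quantum query for $g$ (in the standard sense of quantum query complexity); the error is $e^{\mathrm{quant}}(A,\mathcal{G}^r)=\sup_{g\in\mathcal{G}^r}\inf\{\alpha:\mathbf{P}(e^\omega(A,g)>\alpha)\leq 1/4\}$; the cost is the number of quantum query calls. The $\varepsilon$-complexity $\mathrm{comp}(\mathcal{G}^r,\varepsilon)$ in each setting is the minimal cost of an algorithm $A$ with $e(A,\mathcal{G}^r)\leq\varepsilon$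 in that setting. *)

theory Defs
  imports "HOL-Probability.Probability"
begin

text \<open>A point (x, y_0, ..., y_q) of [a,b] x R^(q+1) is encoded as z :: nat => real with
  z 0 = x, z (j+1) = y_j for j <= q, and z i = 0 for i > q+1.\<close>

type_synonym pt = "nat \<Rightarrow> real"
type_synonym rhs = "pt \<Rightarrow> real"

definition dom_pts :: "real \<Rightarrow> real \<Rightarrow> nat \<Rightarrow> pt set" where
  "dom_pts a b q = {z. z 0 \<in> {a..b} \<and> (\<forall>i>Suc q. z i = 0)}"

text \<open>Set along which the i-th coordinate varies (one-sided at the ends of [a,b] in x).\<close>
definition coord_set :: "real \<Rightarrow> real \<Rightarrow> nat \<Rightarrow> real set" where
  "coord_set a b i = (if i = 0 then {a..b} else UNIV)"

definition pder :: "real \<Rightarrow> real \<Rightarrow> nat \<Rightarrow> rhs \<Rightarrow> rhs" where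
  "pder a b i f z = (THE d. ((\<lambda>t. f (z(i := t))) has_real_derivative d) (at (z i) within coord_set a b i))"

fun pders :: "real \<Rightarrow> real \<Rightarrow> nat list \<Rightarrow> rhs \<Rightarrow> rhs" where
  "pders a b [] f = f"
| "pders a b (i # is) f = pder a b i (pders a b is f)"

definition Gclass :: "real \<Rightarrow> real \<Rightarrow> nat \<Rightarrow> nat \<Rightarrow> (nat \<Rightarrow> real) \<Rightarrow> rhs set" where
  "Gclass a b r q D = {g.
     (\<forall>is. set is \<subseteq> {..Suc q} \<and> length is < r \<longrightarrow>
        (\<forall>i\<le>Suc q. \<forall>z\<in>dom_pts a b q. \<exists>d.
           ((\<lambda>t. pders a b is g (z(i := t))) has_real_derivative d) (at (z i) within coord_set a b i)))
   \<and> (\<forall>is. set is \<subseteq> {..Suc q} \<and> length is \<le> r \<longrightarrow>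
        continuous_on (dom_pts a b q) (pders a b is g)
        \<and> (\<forall>z\<in>dom_pts a b q. \<bar>pders a b is g z\<bar> \<le> D (length is)))}"

definition is_solution ::
  "real \<Rightarrow> real \<Rightarrow> nat \<Rightarrow> nat \<Rightarrow> (nat \<Rightarrow> real) \<Rightarrow> rhs \<Rightarrow> (real \<Rightarrow> real) \<Rightarrow> bool" where
  "is_solution a b k q ua g u \<longleftrightarrow> (\<exists>dd :: nat \<Rightarrow> real \<Rightarrow> real.
     dd 0 = u
   \<and> (\<forall>j<k. \<forall>x\<in>{a..b}. (dd j has_real_derivative dd (Suc j) x) (at x within {a..b}))
   \<and> (\<forall>j<k. dd j a = ua j)
   \<and> (\<forall>x\<in>{a..b}. dd k x = g (\<lambda>i. if i = 0 then x else if i \<le> Suc q then dd (i - 1) x else 0)))"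

definition sol :: "real \<Rightarrow> real \<Rightarrow> nat \<Rightarrow> nat \<Rightarrow> (nat \<Rightarrow> real) \<Rightarrow> rhs \<Rightarrow> real \<Rightarrow> real" where
  "sol a b k q ua g x = (THE v. \<exists>u. is_solution a b k q ua g u \<and> u x = v)"

definition approx_err :: "real \<Rightarrow> real \<Rightarrow> nat \<Rightarrow> nat \<Rightarrow> (nat \<Rightarrow> real) \<Rightarrow> rhs \<Rightarrow> (real \<Rightarrow> real) \<Rightarrow> ennreal" where
  "approx_err a b k q ua g l = (SUP x\<in>{a..b}. ennreal \<bar>sol a b k q ua g x - l x\<bar>)"

text \<open>A deterministic adaptive algorithm: the i-th information functional is chosen from the
  previously computed values (a point and a partial derivative, given as list of coordinates),
  the result is a function of all computed values.\<close>
type_synonym dalg = "(nat \<Rightarrow> real list \<Rightarrow> pt \<times> nat list) \<times> (real list \<Rightarrow> real \<Rightarrow> real)"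

fun info :: "real \<Rightarrow> real \<Rightarrow> (nat \<Rightarrow> real list \<Rightarrow> pt \<times> nat list) \<Rightarrow> rhs \<Rightarrow> nat \<Rightarrow> real list" where
  "info a b N g 0 = []"
| "info a b N g (Suc n) = (let ys = info a b N g n in ys @ [pders a b (snd (N n ys)) g (fst (N n ys))])"

definition dalg_valid :: "real \<Rightarrow> real \<Rightarrow> nat \<Rightarrow> nat \<Rightarrow> dalg \<Rightarrow> bool" where
  "dalg_valid a b r q A \<longleftrightarrow> (\<forall>i ys. fst (fst A i ys) \<in> dom_pts a b q
      \<and> set (snd (fst A i ys)) \<subseteq> {..Suc q} \<and> length (snd (fst A i ys)) \<le> r)"

definition dalg_err :: "real \<Rightarrow> real \<Rightarrow> nat \<Rightarrow> nat \<Rightarrow> (nat \<Rightarrow> real) \<Rightarrow> dalg \<Rightarrow> nat \<Rightarrow> rhs \<Rightarrow> ennreal" where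
  "dalg_err a b k q ua A n g = approx_err a b k q ua g (snd A (info a b (fst A) g n))"

text \<open>A randomized algorithm with cost n: a probability measure on deterministic algorithms
  (every probability space with a random choice of deterministic algorithm can be pushed
  forward to such a measure), each using n evaluations, with measurable error.\<close>
definition ralg_valid :: "real \<Rightarrow> real \<Rightarrow> nat \<Rightarrow> nat \<Rightarrow> nat \<Rightarrow> (nat \<Rightarrow> real) \<Rightarrow> (nat \<Rightarrow> real)
    \<Rightarrow> dalg measure \<Rightarrow> nat \<Rightarrow> bool" where
  "ralg_valid a b r q k D ua M n \<longleftrightarrow> prob_space M
     \<and> (\<forall>A\<in>space M. dalg_valid a b r q A)
     \<and> (\<forall>g\<in>Gclass a b r q D. (\<lambda>A. dalg_err a b k q ua A n g) \<in> borel_measurable M)"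

definition rand_err_sq :: "real \<Rightarrow> real \<Rightarrow> nat \<Rightarrow> nat \<Rightarrow> nat \<Rightarrow> (nat \<Rightarrow> real) \<Rightarrow> (nat \<Rightarrow> real)
    \<Rightarrow> dalg measure \<Rightarrow> nat \<Rightarrow> ennreal" where
  "rand_err_sq a b r q k D ua M n =
     (SUP g\<in>Gclass a b r q D. \<integral>\<^sup>+ A. (dalg_err a b k q ua A n g)\<^sup>2 \<partial>M)"

definition comp_rand :: "real \<Rightarrow> real \<Rightarrow> nat \<Rightarrow> nat \<Rightarrow> nat \<Rightarrow> (nat \<Rightarrow> real) \<Rightarrow> (nat \<Rightarrow> real)
    \<Rightarrow> real \<Rightarrow> ereal" where
  "comp_rand a b r q k D ua \<epsilon> = Inf ((\<lambda>n. ereal (real n)) `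
     {n. \<exists>M. ralg_valid a b r q k D ua M n \<and> rand_err_sq a b r q k D ua M n \<le> ennreal (\<epsilon>\<^sup>2)})"

section \<open>Quantum setting (Heinrich's quantum query model)\<close>

text \<open>States on m qubits: vectors indexed by {..<2^m}; operators: matrices indexed likewise.\<close>
definition mat_app :: "nat \<Rightarrow> (nat \<Rightarrow> nat \<Rightarrow> complex) \<Rightarrow> (nat \<Rightarrow> complex) \<Rightarrow> nat \<Rightarrow> complex" where
  "mat_app m U v = (\<lambda>l. if l < 2^m then (\<Sum>j<2^m. U l j * v j) else 0)"

definition unitary_mat :: "nat \<Rightarrow> (nat \<Rightarrow> nat \<Rightarrow> complex) \<Rightarrow> bool" where
  "unitary_mat m U \<longleftrightarrow> (\<forall>i<2^m. \<forall>j<2^m.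
     (\<Sum>l<2^m. cnj (U l i) * U l j) = (if i = j then 1 else 0))"

record qalg =
  qm :: nat
  qm1 :: nat
  qm2 :: nat
  qZ :: "nat set"
  qtau :: "nat \<Rightarrow> pt"
  qbeta :: "real \<Rightarrow> nat"
  qU :: "nat \<Rightarrow> nat \<Rightarrow> nat \<Rightarrow> complex"
  qphi :: "nat \<Rightarrow> real \<Rightarrow> real"

text \<open>Quantum query Q_g |i>|x>|y> = |i>|x (+) beta(g(tau i))>|y> for i in Z (addition mod 2^m''),
  identity otherwise; as a permutation of basis indices l = i + 2^m' x + 2^(m'+m'') y.\<close>
definition qperm :: "qalg \<Rightarrow> rhs \<Rightarrow> nat \<Rightarrow> nat" where
  "qperm A g l = (let i = l mod 2^qm1 A; x = (l div 2^qm1 A) mod 2^qm2 A;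
       y = l div 2^(qm1 A + qm2 A) in
     if i \<in> qZ A then i + 2^qm1 A * ((x + qbeta A (g (qtau A i))) mod 2^qm2 A) + 2^(qm1 A + qm2 A) * y
     else l)"

definition qquery :: "qalg \<Rightarrow> rhs \<Rightarrow> (nat \<Rightarrow> complex) \<Rightarrow> nat \<Rightarrow> complex" where
  "qquery A g v = (\<lambda>l'. \<Sum>l<2^qm A. if qperm A g l = l' then v l else 0)"

fun qstate :: "qalg \<Rightarrow> rhs \<Rightarrow> nat \<Rightarrow> nat \<Rightarrow> complex" where
  "qstate A g 0 = mat_app (qm A) (qU A 0) (\<lambda>l. if l = 0 then 1 else 0)"
| "qstate A g (Suc j) = mat_app (qm A) (qU A (Suc j)) (qquery A g (qstate A g j))"

definition qalg_valid :: "real \<Rightarrow> real \<Rightarrow> nat \<Rightarrow> qalg \<Rightarrow> nat \<Rightarrow> bool" where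
  "qalg_valid a b q A n \<longleftrightarrow> qm1 A + qm2 A \<le> qm A \<and> qZ A \<subseteq> {..<2^qm1 A}
     \<and> (\<forall>i\<in>qZ A. qtau A i \<in> dom_pts a b q) \<and> (\<forall>t. qbeta A t < 2^qm2 A)
     \<and> (\<forall>j\<le>n. unitary_mat (qm A) (qU A j))"

definition qprob_err_gt :: "real \<Rightarrow> real \<Rightarrow> nat \<Rightarrow> nat \<Rightarrow> (nat \<Rightarrow> real) \<Rightarrow> qalg \<Rightarrow> nat \<Rightarrow> rhs \<Rightarrow> ennreal \<Rightarrow> real" where
  "qprob_err_gt a b k q ua A n g \<alpha> =
     (\<Sum>l<2^qm A. if approx_err a b k q ua g (qphi A l) > \<alpha> then (cmod (qstate A g n l))\<^sup>2 else 0)"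

definition quant_err :: "real \<Rightarrow> real \<Rightarrow> nat \<Rightarrow> nat \<Rightarrow> nat \<Rightarrow> (nat \<Rightarrow> real) \<Rightarrow> (nat \<Rightarrow> real)
    \<Rightarrow> qalg \<Rightarrow> nat \<Rightarrow> ennreal" where
  "quant_err a b r q k D ua A n = (SUP g\<in>Gclass a b r q D.
     Inf {\<alpha>. qprob_err_gt a b k q ua A n g \<alpha> \<le> 1/4})"

definition comp_quant :: "real \<Rightarrow> real \<Rightarrow> nat \<Rightarrow> nat \<Rightarrow> nat \<Rightarrow> (nat \<Rightarrow> real) \<Rightarrow> (nat \<Rightarrow> real)
    \<Rightarrow> real \<Rightarrow> ereal" where
  "comp_quant a b r q k D ua \<epsilon> = Inf ((\<lambda>n. ereal (real n)) `
     {n. \<exists>A. qalg_valid a b q A n \<and> quant_err a b r q k D ua A n \<le> ennreal \<epsilon>})"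

end

theory Submission
  imports Defs "HOL-Computational_Algebra.Polynomial"
begin

text \<open>Take right-hand sides \<open>g\<^sub>s(x, y) = \<Sum>i\<in>s. h\<^sub>i(x)\<close> for \<open>s \<subseteq> {..<N}\<close>, where the \<open>h\<^sub>i\<close> are bumps of height
  about \<open>N\<^bsup>-r\<^esup>\<close> on disjoint intervals of length about \<open>1/N\<close> in the left half of \<open>[a, b]\<close>.  The solution at
  \<open>b\<close> is then affine in the bits of \<open>s\<close>, with every weight at least \<open>w = c N\<^bsup>-(r+1)\<^esup>\<close>, and an evaluation of
  \<open>g\<^sub>s\<close> or one of its derivatives reveals at most one bit.

  Randomized setting: for a uniformly random \<open>s\<close>, the bits not seen by a deterministic algorithm with
  \<open>n\<close> evaluations leave a mean square error of at least \<open>(N - n) w\<^sup>2 / 4\<close>; put \<open>N \<ge> 2n\<close>.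

  Quantum setting: this is the adversary method on the edges of the hypercube.  The sum over all
  edges of the inner products of the two states starts at \<open>N 2\<^sup>N\<close>, decreases by at most \<open>2 * 2\<^sup>N\<close> per query, and
  must have dropped by a constant factor at the end, as solutions of adjacent problems differ by
  \<open>w\<close>.  Hence \<open>n\<close> is at least proportional to \<open>N\<close> once the error is at most \<open>w / 4\<close>.\<close>


subsection \<open>A bump function with compact support\<close>

lemma power_dvd_pderiv:
  fixes p q :: "real poly"
  assumes "q ^ Suc n dvd p"
  shows "q ^ n dvd pderiv p"
proof -
  obtain m where "p = q ^ Suc n * m" using assms by (elim dvdE)
  then show ?thesis
    by (simp add: pderiv_mult pderiv_power_Suc del: power_Suc) (simp add: dvd_add dvd_smult)
qed

text \<open>Each differentiation costs at most one factor \<open>q\<close>. With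
  \<open>n = Suc r\<close>, all derivatives of order at most \<open>r\<close> still vanish at the
  roots of \<open>q\<close>.\<close>

lemma power_dvd_pderiv_funpow:
  fixes q :: "real poly"
  shows "j \<le> n \<Longrightarrow> q ^ (n - j) dvd (pderiv ^^ j) (q ^ n)"
proof (induction j)
  case (Suc j)
  then have "q ^ Suc (n - Suc j) dvd (pderiv ^^ j) (q ^ n)"
    by (simp add: Suc_diff_Suc del: power_Suc)
  then show ?case using power_dvd_pderiv by simp
qed simp

text \<open>The bump is \<open>(t * (1 - t)) ^ Suc r\<close> on the unit interval, continued by
  zero, and \<open>\<phi> j\<close> is its \<open>j\<close>-th derivative. A polynomial suffices, as
  only derivatives up to order \<open>r\<close> have to match at 0 and 1.\<close>

lemma bump_exists:
  fixes r :: nat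
  obtains \<phi> :: "nat \<Rightarrow> real \<Rightarrow> real" and \<eta> B :: real where
    "\<And>j t. j < r \<Longrightarrow> (\<phi> j has_real_derivative \<phi> (Suc j) t) (at t)"
    "\<And>j. j \<le> r \<Longrightarrow> continuous_on UNIV (\<phi> j)"
    "\<And>j t. t \<notin> {0<..<1} \<Longrightarrow> j \<le> r \<Longrightarrow> \<phi> j t = 0"
    "\<And>t. 0 \<le> \<phi> 0 t"
    "\<And>t. 1/4 \<le> t \<Longrightarrow> t \<le> 3/4 \<Longrightarrow> \<eta> \<le> \<phi> 0 t" "\<eta> > 0"
    "\<And>j t. j \<le> r \<Longrightarrow> \<bar>\<phi> j t\<bar> \<le> B" "B > 0"
proof -
  define q where "q = [:0, 1, - 1 :: real:]"
  define p where "p j = (pderiv ^^ j) (q ^ Suc r)" for j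
  define \<phi> where "\<phi> j t = (if t \<in> {0..1} then poly (p j) t else 0)" for j t
  have poly_q: "poly q t = t * (1 - t)" for t by (simp add: q_def algebra_simps)
  have root: "poly (p j) t = 0" if "j \<le> r" "t = 0 \<or> t = 1" for j t
  proof -
    have "q ^ Suc (r - j) dvd p j"
      using power_dvd_pderiv_funpow[of j "Suc r" q] that by (simp add: p_def Suc_diff_le)
    then have "q dvd p j" by (metis dvd_mult_left power_Suc)
    then show ?thesis using that poly_q by (auto elim!: dvdE)
  qed
  have frontier: "x = 0 \<or> x = 1"
    if "x \<in> closure {0..1::real}" "x \<in> closure (- {0..1::real})" for x
    using that by (auto simp: closure_complement)
  have deriv: "(\<phi> j has_real_derivative \<phi> (Suc j) t) (at t)" if "j < r" for j t
  proof -
    \<comment> \<open>The two pieces meet only at 0 and 1, where \<open>p j\<close> and, because of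
      \<open>j < r\<close>, also \<open>p (Suc j)\<close> vanish.\<close>
    have "((\<lambda>x. if x \<in> {0..1} then poly (p j) x else 0) has_vector_derivative
        (if t \<in> {0..1} then poly (p (Suc j)) t else 0)) (at t within {0..1} \<union> - {0..1})"
    proof (rule has_vector_derivative_If_within_closures)
      show "t \<in> {0..1} \<union> - {0..1}" by auto
      have "(poly (p j) has_real_derivative poly (p (Suc j)) t) (at t)"
        using poly_DERIV[of "p j" t] by (simp add: p_def)
      then show "(poly (p j) has_vector_derivative poly (p (Suc j)) t)
         (at t within {0..1} \<union> closure {0..1} \<inter> closure (- {0..1}))"
        by (simp add: has_real_derivative_iff_has_vector_derivative has_vector_derivative_at_within)
    qed (use frontier root that in auto)
    then show ?thesis
      unfolding \<phi>_def by (simp add: has_real_derivative_iff_has_vector_derivative Compl_partition)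
  qed
  have zero: "\<phi> j t = 0" if "t \<notin> {0<..<1}" "j \<le> r" for j t
  proof -
    have "t = 0 \<or> t = 1 \<or> t \<notin> {0..1}" using that by auto
    then show ?thesis using root that by (auto simp: \<phi>_def)
  qed
  have cont: "continuous_on UNIV (\<phi> j)" if "j \<le> r" for j
  proof -
    have "continuous_on ({0..1} \<union> closure (- {0..1})) (\<lambda>x. if x \<in> {0..1} then poly (p j) x else 0)"
    proof (rule continuous_on_If)
      show "closed {0..1::real}" "closed (closure (- {0..1::real}))" by auto
    qed (use root frontier that in \<open>auto simp: closure_subset[THEN subsetD] intro!: continuous_intros\<close>)
    moreover have "{0..1} \<union> closure (- {0..1::real}) = UNIV"
      using closure_subset[of "- {0..1::real}"] by auto
    ultimately show ?thesis unfolding \<phi>_def by simp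
  qed
  have "\<exists>B. \<forall>t. \<bar>\<phi> j t\<bar> \<le> B" if "j \<le> r" for j
  proof -
    have "compact (\<phi> j ` {0..1})"
      using cont[OF that] by (intro compact_continuous_image) (auto intro: continuous_on_subset)
    then obtain B where B: "\<forall>y\<in>\<phi> j ` {0..1}. \<bar>y\<bar> \<le> B"
      using compact_imp_bounded bounded_real by metis
    have "\<bar>\<phi> j t\<bar> \<le> max B 0" for t
      using B by (cases "t \<in> {0..1}") (auto simp: \<phi>_def le_max_iff_disj)
    then show ?thesis by blast
  qed
  then obtain B where B: "\<And>j t. j \<le> r \<Longrightarrow> \<bar>\<phi> j t\<bar> \<le> B j" by metis
  define B' where "B' = 1 + (\<Sum>j\<le>r. \<bar>B j\<bar>)"
  have B': "\<bar>\<phi> j t\<bar> \<le> B'" if "j \<le> r" for j t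
  proof -
    have "\<bar>B j\<bar> \<le> (\<Sum>j\<le>r. \<bar>B j\<bar>)" by (rule member_le_sum) (use that in auto)
    then show ?thesis using B[OF that, of t] unfolding B'_def by linarith
  qed
  have "B' > 0" unfolding B'_def by (smt (verit) sum_nonneg abs_ge_zero)
  have phi0: "\<phi> 0 t = (if t \<in> {0..1} then (t * (1 - t)) ^ Suc r else 0)" for t
    by (simp add: \<phi>_def p_def poly_q poly_power del: power_Suc)
  have "(3/16) ^ Suc r \<le> \<phi> 0 t" if "1/4 \<le> t" "t \<le> 3/4" for t
  proof -
    \<comment> \<open>The product equals \<open>t * (1 - t) - 3/16\<close>.\<close>
    have "0 \<le> (t - 1/4) * (3/4 - t)" using that by simp
    then have "3/16 \<le> t * (1 - t)" by (simp add: field_simps)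
    then have "(3/16) ^ Suc r \<le> (t * (1 - t)) ^ Suc r" by (intro power_mono) auto
    then show ?thesis using that by (simp add: phi0 del: power_Suc)
  qed
  moreover have "0 \<le> \<phi> 0 t" for t
    unfolding phi0 by (auto simp del: power_Suc intro!: zero_le_power mult_nonneg_nonneg)
  ultimately show thesis
    using deriv cont zero B' \<open>B' > 0\<close> by (intro that[of \<phi> "(3/16) ^ Suc r" B']) auto
qed

subsection \<open>Iterated antiderivatives\<close>

text \<open>The sequence \<open>dd\<close> of successive derivatives has the shape demanded by
  \<open>is_solution\<close>. The induction adds a new lowest order: build the tower for the shifted
  initial values, then integrate its \<open>dd 0\<close> once more.\<close>

lemma iterated_antiderivative:
  fixes h :: "real \<Rightarrow> real"
  assumes "continuous_on {a..b} h"
  shows "\<exists>dd. (\<forall>j<k. \<forall>x\<in>{a..b}. (dd j has_real_derivative dd (Suc j) x) (at x within {a..b}))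
    \<and> (\<forall>j<k. dd j a = c j) \<and> dd k = h"
proof (induction k arbitrary: c)
  case 0
  show ?case by (intro exI[of _ "\<lambda>_. h"]) simp
next
  case (Suc k)
  obtain dd where dd:
    "\<forall>j<k. \<forall>x\<in>{a..b}. (dd j has_real_derivative dd (Suc j) x) (at x within {a..b})"
    "\<forall>j<k. dd j a = c (Suc j)" "dd k = h" using Suc[of "\<lambda>j. c (Suc j)"] by metis
  have cont: "continuous_on {a..b} (dd 0)"
  proof (cases k)
    case 0 then show ?thesis using dd assms by simp
  next
    case (Suc m)
    then have "(dd 0 has_real_derivative dd (Suc 0) x) (at x within {a..b})" if "x \<in> {a..b}" for x
      using dd(1) that by blast
    then show ?thesis by (rule DERIV_continuous_on)
  qed
  define ee where "ee j = (case j of 0 \<Rightarrow> (\<lambda>x. c 0 + integral {a..x} (dd 0)) | Suc i \<Rightarrow> dd i)" for j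
  have "(ee j has_real_derivative ee (Suc j) x) (at x within {a..b})" if "j < Suc k" "x \<in> {a..b}" for j x
  proof (cases j)
    case 0
    then show ?thesis
      using integral_has_real_derivative[OF cont that(2)]
      by (auto simp: ee_def intro!: derivative_eq_intros)
  qed (use dd that in \<open>auto simp: ee_def\<close>)
  moreover have "ee j a = c j" if "j < Suc k" for j
    using that dd by (cases j) (auto simp: ee_def)
  ultimately show ?case using dd by (intro exI[of _ ee]) (auto simp: ee_def)
qed

text \<open>The difference \<open>g - f\<close> has a nonnegative derivative. Derivatives are taken
  within \<open>{a..b}\<close>, so the one-sided ones at the end points are covered.\<close>

lemma deriv_le_imp_le:
  fixes f g :: "real \<Rightarrow> real"
  assumes "{x..y} \<subseteq> {a..b}" "x \<le> y"
    and "\<And>t. t \<in> {x..y} \<Longrightarrow> (f has_real_derivative f' t) (at t within {a..b})"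
    and "\<And>t. t \<in> {x..y} \<Longrightarrow> (g has_real_derivative g' t) (at t within {a..b})"
    and "\<And>t. t \<in> {x..y} \<Longrightarrow> f' t \<le> g' t"
  shows "f y - f x \<le> g y - g x"
proof -
  have "(\<lambda>t. g t - f t) x \<le> (\<lambda>t. g t - f t) y"
  proof (rule DERIV_nonneg_imp_increasing_open[OF \<open>x \<le> y\<close>])
    have *: "((\<lambda>t. g t - f t) has_real_derivative g' t - f' t) (at t within {x..y})"
      if "t \<in> {x..y}" for t
      using that assms(1,3,4) by (intro DERIV_diff) (blast intro: DERIV_subset)+
    then show "continuous_on {x..y} (\<lambda>t. g t - f t)" by (rule DERIV_continuous_on)
    fix t assume t: "x < t" "t < y"
    then show "\<exists>d. ((\<lambda>t. g t - f t) has_real_derivative d) (at t) \<and> 0 \<le> d"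
      using *[of t] assms(5)[of t] at_within_Icc_at[of x t y] by auto
  qed
  then show ?thesis by simp
qed

lemma iterated_antiderivative_nonneg:
  fixes dd :: "nat \<Rightarrow> real \<Rightarrow> real"
  assumes deriv: "\<forall>j<k. \<forall>x\<in>{a..b}. (dd j has_real_derivative dd (Suc j) x) (at x within {a..b})"
    and init: "\<forall>j<k. dd j a = 0" and pos: "\<And>x. x \<in> {a..b} \<Longrightarrow> 0 \<le> dd k x"
  shows "j \<le> k \<Longrightarrow> x \<in> {a..b} \<Longrightarrow> 0 \<le> dd j x"
proof (induction arbitrary: x rule: inc_induct)
  case base
  then show ?case using pos by simp
next
  case (step j)
  have "0 - 0 \<le> dd j x - dd j a"
    by (rule deriv_le_imp_le[where a = a and b = b and f' = "\<lambda>_. 0" and g' = "dd (Suc j)"])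
       (use step deriv in auto)
  then show ?case using init step by simp
qed

text \<open>Up to \<open>l'\<close> the derivative of order \<open>k\<close> gains
  \<open>\<eta> * (l' - l)\<close>, which it keeps on \<open>{m..b}\<close> since it never
  decreases. Each of the remaining \<open>k\<close> integrations starts at \<open>m\<close>, where
  the lower orders are nonnegative. The factor \<open>(b - m) ^ k\<close> does not depend on where
  in \<open>{a..m}\<close> the bump sits.\<close>

lemma iterated_antiderivative_lower:
  fixes dd :: "nat \<Rightarrow> real \<Rightarrow> real"
  assumes deriv: "\<forall>j<Suc k. \<forall>x\<in>{a..b}. (dd j has_real_derivative dd (Suc j) x) (at x within {a..b})"
    and init: "\<forall>j<Suc k. dd j a = 0" and pos: "\<And>x. x \<in> {a..b} \<Longrightarrow> 0 \<le> dd (Suc k) x"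
    and \<eta>: "\<And>x. x \<in> {l..l'} \<Longrightarrow> \<eta> \<le> dd (Suc k) x"
    and "a \<le> l" "l \<le> l'" "l' \<le> m" "m \<le> b"
  shows "\<eta> * (l' - l) * (b - m) ^ k / fact k \<le> dd 0 b"
proof -
  note nonneg = iterated_antiderivative_nonneg[OF deriv init pos]
  have "\<eta> * (l' - l) * (x - m) ^ j / fact j \<le> dd (k - j) x" if "j \<le> k" "x \<in> {m..b}" for j x
    using that
  proof (induction j arbitrary: x)
    case 0
    have "\<eta> * l' - \<eta> * l \<le> dd k l' - dd k l"
      by (rule deriv_le_imp_le[where a = a and b = b and f' = "\<lambda>_. \<eta>" and g' = "dd (Suc k)"])
         (use assms in \<open>auto intro!: derivative_eq_intros\<close>)
    moreover have "0 - 0 \<le> dd k x - dd k l'"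
      by (rule deriv_le_imp_le[where a = a and b = b and f' = "\<lambda>_. 0" and g' = "dd (Suc k)"])
         (use assms 0 in auto)
    moreover have "0 \<le> dd k l" using nonneg assms by auto
    ultimately show ?case by (simp add: algebra_simps)
  next
    case (Suc j)
    let ?f = "\<lambda>x. \<eta> * (l' - l) * (x - m) ^ Suc j / fact (Suc j)"
    have eq: "Suc (k - Suc j) = k - j" using Suc by simp
    have "?f x - ?f m \<le> dd (k - Suc j) x - dd (k - Suc j) m"
    proof (rule deriv_le_imp_le[where a = a and b = b
            and f' = "\<lambda>x. \<eta> * (l' - l) * (x - m) ^ j / fact j" and g' = "dd (k - j)"])
      show "(?f has_real_derivative \<eta> * (l' - l) * (t - m) ^ j / fact j) (at t within {a..b})" for t
        by (rule derivative_eq_intros refl | simp add: divide_simps del: of_nat_Suc)+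
    qed (use deriv[rule_format, of "k - Suc j"] Suc assms eq in auto)
    moreover have "0 \<le> dd (k - Suc j) m" using nonneg assms by auto
    ultimately show ?case by simp
  qed
  from this[of k b] show ?thesis using assms by simp
qed

subsection \<open>Right-hand sides depending on x only\<close>

text \<open>No point of the coordinate set is isolated, so the definite description in
  \<open>pder\<close> can be evaluated.\<close>

lemma has_real_derivative_unique_within:
  fixes f :: "real \<Rightarrow> real"
  assumes "a < b" "i = 0 \<longrightarrow> x \<in> {a..b}"
    and "(f has_real_derivative d) (at x within coord_set a b i)"
    and "(f has_real_derivative d') (at x within coord_set a b i)"
  shows "d = d'"
proof -
  have "at x within coord_set a b i \<noteq> bot"
    using assms(1,2) by (auto simp: coord_set_def trivial_limit_within islimpt_Icc)
  then show ?thesis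
    using assms(3,4) vector_derivative_unique_within
    by (metis has_real_derivative_iff_has_vector_derivative)
qed

lemma dom_pts_upd:
  assumes "z \<in> dom_pts a b q" "i \<le> Suc q" "t \<in> coord_set a b i"
  shows "z(i := t) \<in> dom_pts a b q"
  using assms by (auto simp: dom_pts_def coord_set_def split: if_splits)

lemma dom_pts_coord:
  assumes "z \<in> dom_pts a b q"
  shows "z i \<in> coord_set a b i"
  using assms by (auto simp: dom_pts_def coord_set_def)

context
  fixes F :: "nat \<Rightarrow> real \<Rightarrow> real" and a b :: real and r q :: nat
  assumes ab: "a < b"
    and F: "\<And>j x. j < r \<Longrightarrow> x \<in> {a..b} \<Longrightarrow> (F j has_real_derivative F (Suc j) x) (at x within {a..b})"
begin

text \<open>\<open>G\<close> stands for an iterated derivative whose formula is known on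
  \<open>dom_pts\<close> only. Moving one coordinate inside \<open>coord_set\<close> stays in
  \<open>dom_pts\<close>, so the formula may be differentiated instead; any y-direction yields
  zero.\<close>

lemma pders_x_only_deriv:
  assumes eq: "\<And>z. z \<in> dom_pts a b q \<Longrightarrow> G z = (if set is \<subseteq> {0} then F (length is) (z 0) else 0)"
    and "length is < r" "i \<le> Suc q" "z \<in> dom_pts a b q"
  shows "((\<lambda>t. G (z(i := t))) has_real_derivative
      (if set (i # is) \<subseteq> {0} then F (length (i # is)) (z 0) else 0)) (at (z i) within coord_set a b i)"
proof -
  have z0: "z 0 \<in> {a..b}" using assms by (simp add: dom_pts_def)
  have "((\<lambda>t. if set is \<subseteq> {0} then F (length is) ((z(i := t)) 0) else 0) has_real_derivative
      (if set (i # is) \<subseteq> {0} then F (length (i # is)) (z 0) else 0)) (at (z i) within coord_set a b i)"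
    using F[OF assms(2) z0] by (cases "set is \<subseteq> {0}"; cases "i = 0") (auto simp: coord_set_def)
  then show ?thesis
    by (rule has_field_derivative_transform_within[OF _ zero_less_one dom_pts_coord])
       (use assms dom_pts_upd in auto)
qed

lemma pders_x_only:
  assumes "z \<in> dom_pts a b q" "set is \<subseteq> {..Suc q}" "length is \<le> r"
  shows "pders a b is (\<lambda>z. F 0 (z 0)) z = (if set is \<subseteq> {0} then F (length is) (z 0) else 0)"
  using assms
proof (induction "is" arbitrary: z)
  case (Cons i "is")
  have "((\<lambda>t. pders a b is (\<lambda>z. F 0 (z 0)) (z(i := t))) has_real_derivative
      (if set (i # is) \<subseteq> {0} then F (length (i # is)) (z 0) else 0)) (at (z i) within coord_set a b i)"
    by (rule pders_x_only_deriv) (use Cons in auto)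
  moreover have "i = 0 \<longrightarrow> z i \<in> {a..b}" using Cons(2) by (auto simp: dom_pts_def)
  ultimately show ?case
    unfolding pders.simps pder_def
    by (intro the_equality) (assumption, erule (2) has_real_derivative_unique_within[OF ab, rotated 2])
qed simp

lemma x_only_in_Gclass:
  assumes cont: "\<And>j. j \<le> r \<Longrightarrow> continuous_on {a..b} (F j)"
    and bound: "\<And>j x. j \<le> r \<Longrightarrow> x \<in> {a..b} \<Longrightarrow> \<bar>F j x\<bar> \<le> D j"
  shows "(\<lambda>z. F 0 (z 0)) \<in> Gclass a b r q D"
  unfolding Gclass_def mem_Collect_eq
proof (intro conjI allI impI ballI)
  fix "is" i z assume "set is \<subseteq> {..Suc q} \<and> length is < r" "i \<le> Suc q" "z \<in> dom_pts a b q"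
  then show "\<exists>d. ((\<lambda>t. pders a b is (\<lambda>z. F 0 (z 0)) (z(i := t))) has_real_derivative d)
      (at (z i) within coord_set a b i)"
    using pders_x_only_deriv[of "pders a b is (\<lambda>z. F 0 (z 0))" "is" i z] pders_x_only by fastforce
next
  fix "is" assume "is": "set is \<subseteq> {..Suc q} \<and> length is \<le> r"
  have "continuous_on (dom_pts a b q) (\<lambda>z. F (length is) (z 0))"
    by (rule continuous_on_compose2[OF cont])
       (use "is" in \<open>auto simp: dom_pts_def intro: continuous_on_subset[OF continuous_on_product_coordinates]\<close>)
  then show "continuous_on (dom_pts a b q) (pders a b is (\<lambda>z. F 0 (z 0)))"
    using "is" by (subst continuous_on_cong[OF refl pders_x_only]) (cases "set is \<subseteq> {0}"; auto)+
  fix z assume z: "z \<in> dom_pts a b q"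
  then have "z 0 \<in> {a..b}" by (simp add: dom_pts_def)
  \<comment> \<open>For derivatives in some y-direction the value is 0, and
    \<open>D (length is)\<close> is nonnegative because it bounds an absolute value.\<close>
  from bound[OF _ this, of "length is"] show "\<bar>pders a b is (\<lambda>z. F 0 (z 0)) z\<bar> \<le> D (length is)"
    using "is" pders_x_only[OF z] by auto
qed

end

text \<open>Without dependence on y the problem is \<open>k\<close>-fold integration. Uniqueness,
  needed for the description in \<open>sol\<close>, descends from order \<open>k\<close>: equal
  derivatives and equal initial values give equal functions.\<close>

lemma sol_x_only:
  fixes dd :: "nat \<Rightarrow> real \<Rightarrow> real"
  assumes "a < b" "x \<in> {a..b}"
    and deriv: "\<forall>j<k. \<forall>x\<in>{a..b}. (dd j has_real_derivative dd (Suc j) x) (at x within {a..b})"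
    and init: "\<forall>j<k. dd j a = ua j" and rhs: "\<And>x. x \<in> {a..b} \<Longrightarrow> dd k x = f x"
  shows "sol a b k q ua (\<lambda>z. f (z 0)) x = dd 0 x"
  unfolding sol_def
proof (rule the_equality)
  have "is_solution a b k q ua (\<lambda>z. f (z 0)) (dd 0)"
    unfolding is_solution_def by (rule exI[of _ dd]) (use assms in auto)
  then show "\<exists>u. is_solution a b k q ua (\<lambda>z. f (z 0)) u \<and> u x = dd 0 x" by blast
next
  fix v assume "\<exists>u. is_solution a b k q ua (\<lambda>z. f (z 0)) u \<and> u x = v"
  then obtain ee where ee: "ee 0 x = v"
    "\<forall>j<k. \<forall>x\<in>{a..b}. (ee j has_real_derivative ee (Suc j) x) (at x within {a..b})"
    "\<forall>j<k. ee j a = ua j" "\<forall>x\<in>{a..b}. ee k x = f x"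
    unfolding is_solution_def by auto
  have "ee j x = dd j x" if "j \<le> k" "x \<in> {a..b}" for j x
    using that
  proof (induction arbitrary: x rule: inc_induct)
    case base
    then show ?case using ee rhs by simp
  next
    case (step j)
    have "ee j x - ee j a \<le> dd j x - dd j a"
      by (rule deriv_le_imp_le[where a = a and b = b and f' = "ee (Suc j)" and g' = "dd (Suc j)"])
         (use step deriv ee in auto)
    moreover have "dd j x - dd j a \<le> ee j x - ee j a"
      by (rule deriv_le_imp_le[where a = a and b = b and f' = "dd (Suc j)" and g' = "ee (Suc j)"])
         (use step deriv ee in auto)
    ultimately show ?case using init ee step by simp
  qed
  then show "v = dd 0 x" using ee(1) assms(2) by auto
qed

subsection \<open>Flipping bits on the hypercube\<close>

definition flip :: "nat \<Rightarrow> nat set \<Rightarrow> nat set" where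
  "flip i s = (if i \<in> s then s - {i} else insert i s)"

lemma flip_flip [simp]: "flip i (flip i s) = s"
  by (auto simp: flip_def)

lemma flip_mem: "j \<in> flip i s \<longleftrightarrow> (if j = i then i \<notin> s else j \<in> s)"
  by (auto simp: flip_def)

lemma flip_Pow: "i < N \<Longrightarrow> s \<in> Pow {..<N} \<Longrightarrow> flip i s \<in> Pow {..<N}"
  by (auto simp: flip_def split: if_splits)

lemma sum_flip:
  assumes "i < N"
  shows "(\<Sum>s\<in>Pow {..<N}. F (flip i s)) = (\<Sum>s\<in>Pow {..<N}. F s)"
  by (rule sum.reindex_bij_witness[of _ "flip i" "flip i"]) (use assms flip_Pow in auto)

definition sgn_bit :: "nat set \<Rightarrow> nat \<Rightarrow> real" where
  "sgn_bit s i = (if i \<in> s then 1 else - 1)"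

lemma sgn_bit_flip: "sgn_bit (flip i s) j = (if j = i then - sgn_bit s j else sgn_bit s j)"
  by (simp add: sgn_bit_def flip_mem)

lemma sgn_bit_square: "sgn_bit s i * sgn_bit s i = 1"
  by (simp add: sgn_bit_def)

lemma sum_flip_weight:
  fixes wt :: "nat \<Rightarrow> real"
  assumes "finite s"
  shows "(\<Sum>j\<in>flip i s. wt j) = (\<Sum>j\<in>s. wt j) - wt i * sgn_bit s i"
  using assms by (auto simp: flip_def sgn_bit_def sum_diff1)

text \<open>With \<open>R\<close> the deviation and \<open>U\<close> the contribution of the unqueried bits, \<open>R\<^sup>2 \<ge> U * (2 * R - U)\<close>.
  Flipping an unqueried bit \<open>i\<close> changes both \<open>U\<close> and \<open>2 * R - U\<close> by \<open>- wt i * sgn_bit s i\<close>, so that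
  pairing \<open>s\<close> with \<open>flip i s\<close> leaves \<open>(wt i)\<^sup>2 / 4\<close> on average, whatever \<open>f\<close> is.\<close>
lemma sum_squares_unqueried:
  fixes wt :: "nat \<Rightarrow> real" and f :: "nat set \<Rightarrow> real" and w :: real
  assumes Q: "\<And>s i. s \<subseteq> {..<N} \<Longrightarrow> i < N \<Longrightarrow> i \<notin> Q s \<Longrightarrow> Q (flip i s) = Q s \<and> f (flip i s) = f s"
    and card: "\<And>s. s \<subseteq> {..<N} \<Longrightarrow> card ({..<N} \<inter> Q s) \<le> n"
    and wt: "\<And>i. i < N \<Longrightarrow> w \<le> wt i" and "0 \<le> w"
  shows "2 ^ N * (real N - real n) * w\<^sup>2 / 4 \<le> (\<Sum>s\<in>Pow {..<N}. ((\<Sum>i\<in>s. wt i) - f s)\<^sup>2)"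
proof -
  define R where "R s = (\<Sum>i\<in>s. wt i) - f s" for s
  define U where "U s = (\<Sum>i\<in>{..<N} - Q s. wt i * sgn_bit s i) / 2" for s
  define X where "X s = 2 * R s - U s" for s
  define T where "T i s = (if i \<notin> Q s then wt i * sgn_bit s i / 2 * X s else 0)" for i s
  have X_flip: "X (flip i s) = X s - wt i * sgn_bit s i"
    if s: "s \<subseteq> {..<N}" and i: "i < N" "i \<notin> Q s" for s i
  proof -
    have fin: "finite s" using s finite_subset by blast
    have R: "R (flip i s) = R s - wt i * sgn_bit s i"
      using Q[OF s i] sum_flip_weight[OF fin] by (simp add: R_def)
    have mem: "i \<in> {..<N} - Q s" using i by simp
    have "(\<Sum>j\<in>{..<N} - Q s. wt j * sgn_bit (flip i s) j)
        = - (wt i * sgn_bit s i) + (\<Sum>j\<in>{..<N} - Q s - {i}. wt j * sgn_bit s j)"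
      by (subst sum.remove[OF _ mem]) (auto simp: sgn_bit_flip)
    also have "\<dots> = (\<Sum>j\<in>{..<N} - Q s. wt j * sgn_bit s j) - 2 * (wt i * sgn_bit s i)"
      using sum.remove[OF _ mem, of "\<lambda>j. wt j * sgn_bit s j"] by simp
    finally have "U (flip i s) = U s - wt i * sgn_bit s i"
      using Q[OF s i] by (simp add: U_def)
    with R show ?thesis by (simp add: X_def)
  qed
  \<comment> \<open>Since the sign flips while \<open>X\<close> drops by
    \<open>wt i * sgn_bit s i\<close>, the terms with \<open>X s\<close> cancel and only the square
    remains.\<close>
  have pair: "T i s + T i (flip i s) = (if i \<notin> Q s then (wt i)\<^sup>2 / 2 else 0)"
    if s: "s \<subseteq> {..<N}" and i: "i < N" for s i
  proof (cases "i \<in> Q s")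
    case False
    have "i \<notin> Q (flip i s)" using Q[OF s i False] False by simp
    then have "T i s + T i (flip i s) = (wt i)\<^sup>2 / 2 * (sgn_bit s i * sgn_bit s i)"
      using False X_flip[OF s i False] by (simp add: T_def sgn_bit_flip power2_eq_square) (simp add: algebra_simps)
    then show ?thesis using False by (simp add: sgn_bit_square)
  next
    case True
    \<comment> \<open>Otherwise flipping back would make \<open>i\<close> unqueried at
      \<open>s\<close> as well.\<close>
    have "i \<in> Q (flip i s)"
      using Q[of "flip i s" i] flip_Pow[OF i, of s] s i True by auto
    then show ?thesis using True by (simp add: T_def)
  qed
  have T_sum: "(\<Sum>s\<in>Pow {..<N}. T i s) = (\<Sum>s\<in>Pow {..<N}. if i \<notin> Q s then (wt i)\<^sup>2 / 4 else 0)"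
    if "i < N" for i
  proof -
    have "2 * (\<Sum>s\<in>Pow {..<N}. T i s) = (\<Sum>s\<in>Pow {..<N}. T i s + T i (flip i s))"
      using sum_flip[OF that, of "T i"] by (simp add: sum.distrib)
    also have "\<dots> = (\<Sum>s\<in>Pow {..<N}. 2 * (if i \<notin> Q s then (wt i)\<^sup>2 / 4 else 0))"
      by (rule sum.cong) (use pair that in auto)
    finally show ?thesis by (simp add: sum_distrib_left[symmetric])
  qed
  have "2 ^ N * (real N - real n) * w\<^sup>2 / 4 = (\<Sum>s\<in>Pow {..<N}. (real N - real n) * (w\<^sup>2 / 4))"
    by (simp add: card_Pow)
  also have "\<dots> \<le> (\<Sum>s\<in>Pow {..<N}. \<Sum>i<N. if i \<notin> Q s then (wt i)\<^sup>2 / 4 else 0)"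
  proof (rule sum_mono)
    fix s assume "s \<in> Pow {..<N}"
    then have "card ({..<N} \<inter> Q s) \<le> n" using card by simp
    then have "real N - real n \<le> card ({..<N} - Q s)"
      by (simp add: card_Diff_subset_Int)
    then have "(real N - real n) * (w\<^sup>2 / 4) \<le> (\<Sum>i\<in>{..<N} - Q s. w\<^sup>2 / 4)"
      by (simp add: mult_right_mono)
    also have "\<dots> \<le> (\<Sum>i\<in>{..<N} - Q s. (wt i)\<^sup>2 / 4)"
      using wt \<open>0 \<le> w\<close> by (intro sum_mono divide_right_mono power_mono) auto
    also have "\<dots> = (\<Sum>i<N. if i \<notin> Q s then (wt i)\<^sup>2 / 4 else 0)"
      by (intro sum.mono_neutral_cong_left) auto
    finally show "(real N - real n) * (w\<^sup>2 / 4) \<le> (\<Sum>i<N. if i \<notin> Q s then (wt i)\<^sup>2 / 4 else 0)" .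
  qed
  also have "\<dots> = (\<Sum>i<N. \<Sum>s\<in>Pow {..<N}. if i \<notin> Q s then (wt i)\<^sup>2 / 4 else 0)"
    by (rule sum.swap)
  also have "\<dots> = (\<Sum>i<N. \<Sum>s\<in>Pow {..<N}. T i s)" using T_sum by simp
  also have "\<dots> = (\<Sum>s\<in>Pow {..<N}. \<Sum>i<N. T i s)" by (rule sum.swap)
  also have "\<dots> = (\<Sum>s\<in>Pow {..<N}. U s * X s)"
  proof (rule sum.cong)
    fix s
    have "(\<Sum>i<N. T i s) = (\<Sum>i\<in>{..<N} - Q s. wt i * sgn_bit s i / 2 * X s)"
      unfolding T_def by (intro sum.mono_neutral_cong_right) auto
    then show "(\<Sum>i<N. T i s) = U s * X s"
      by (simp add: U_def sum_distrib_right sum_divide_distrib)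
  qed simp
  also have "\<dots> \<le> (\<Sum>s\<in>Pow {..<N}. (R s)\<^sup>2)"
  proof (rule sum_mono)
    fix s
    have "(R s)\<^sup>2 - U s * X s = (R s - U s)\<^sup>2" by (simp add: X_def power2_eq_square algebra_simps)
    then show "U s * X s \<le> (R s)\<^sup>2" by (smt (verit) zero_le_power2)
  qed
  finally show ?thesis by (simp add: R_def)
qed

subsection \<open>Inner products of quantum states\<close>

definition ip :: "nat \<Rightarrow> (nat \<Rightarrow> complex) \<Rightarrow> (nat \<Rightarrow> complex) \<Rightarrow> complex" where
  "ip M u v = (\<Sum>l<M. cnj (u l) * v l)"

lemma ip_self: "ip M u u = (\<Sum>l<M. (cmod (u l))\<^sup>2)"
  by (simp add: ip_def complex_norm_square[symmetric] mult.commute[of "cnj _"] del: of_real_power)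

lemma ip_mat_app:
  assumes "unitary_mat m U"
  shows "ip (2^m) (mat_app m U u) (mat_app m U v) = ip (2^m) u v"
proof -
  have "ip (2^m) (mat_app m U u) (mat_app m U v)
      = (\<Sum>l<2^m. \<Sum>i<2^m. \<Sum>j<2^m. cnj (u i) * v j * (cnj (U l i) * U l j))"
    by (simp add: ip_def mat_app_def sum_product) (simp add: mult_ac)
  also have "\<dots> = (\<Sum>i<2^m. \<Sum>l<2^m. \<Sum>j<2^m. cnj (u i) * v j * (cnj (U l i) * U l j))"
    by (rule sum.swap)
  also have "\<dots> = (\<Sum>i<2^m. \<Sum>j<2^m. \<Sum>l<2^m. cnj (u i) * v j * (cnj (U l i) * U l j))"
    by (intro sum.cong refl sum.swap)
  also have "\<dots> = (\<Sum>i<2^m. \<Sum>j<2^m. if i = j then cnj (u i) * v j else 0)"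
    using assms by (intro sum.cong refl)
      (auto simp: sum_distrib_left[symmetric] unitary_mat_def)
  also have "\<dots> = ip (2^m) u v" by (simp add: ip_def)
  finally show ?thesis .
qed

lemma norm_sum_cnj_mult_le:
  "cmod (\<Sum>l\<in>S. cnj (u l) * v l) \<le> (\<Sum>l\<in>S. (cmod (u l))\<^sup>2) / 2 + (\<Sum>l\<in>S. (cmod (v l))\<^sup>2) / 2"
proof -
  have "cmod (\<Sum>l\<in>S. cnj (u l) * v l) \<le> (\<Sum>l\<in>S. (cmod (u l))\<^sup>2 / 2 + (cmod (v l))\<^sup>2 / 2)"
  proof (rule sum_norm_le)
    fix l
    show "cmod (cnj (u l) * v l) \<le> (cmod (u l))\<^sup>2 / 2 + (cmod (v l))\<^sup>2 / 2"
      using sum_squares_bound[of "cmod (u l)" "cmod (v l)"] by (simp add: norm_mult)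
  qed
  then show ?thesis by (simp add: sum.distrib sum_divide_distrib)
qed

text \<open>This is the effect of one query on an inner product. Outside \<open>K\<close> both
  states are permuted alike and contribute the same as before. On \<open>K\<close>, AM-GM bounds the
  contribution before and after by half of the two masses each, and these masses are preserved
  because \<open>K\<close> is invariant.\<close>

lemma ip_permuted:
  fixes u v u' v' :: "nat \<Rightarrow> complex"
  assumes bij: "bij_betw \<pi> {..<M} {..<M}" "bij_betw \<rho> {..<M} {..<M}"
    and u': "\<And>l. l < M \<Longrightarrow> u' (\<pi> l) = u l" and v': "\<And>l. l < M \<Longrightarrow> v' (\<rho> l) = v l"
    and K: "K \<subseteq> {..<M}" "\<pi> ` K = K" "\<rho> ` K = K"
    and eq: "\<And>l. l < M \<Longrightarrow> l \<notin> K \<Longrightarrow> \<pi> l = \<rho> l"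
  shows "cmod (ip M u' v' - ip M u v) \<le> (\<Sum>l\<in>K. (cmod (u l))\<^sup>2) + (\<Sum>l\<in>K. (cmod (v l))\<^sup>2)"
proof -
  have inj: "inj_on \<pi> {..<M}" "inj_on \<rho> {..<M}" using bij by (auto simp: bij_betw_def)
  have injK: "inj_on \<pi> K" "inj_on \<rho> K" using inj K(1) by (auto intro: inj_on_subset)
  have "\<pi> ` ({..<M} - K) = {..<M} - K"
    using inj_on_image_set_diff[OF inj(1), of "{..<M}" K] K(1,2) bij(1)
    by (simp add: bij_betw_def)
  moreover have "inj_on \<pi> ({..<M} - K)" using inj by (auto intro: inj_on_subset)
  ultimately have "(\<Sum>l\<in>{..<M} - K. cnj (u' l) * v' l) = (\<Sum>l\<in>{..<M} - K. cnj (u' (\<pi> l)) * v' (\<pi> l))"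
    using sum.reindex[of \<pi> "{..<M} - K" "\<lambda>l. cnj (u' l) * v' l"] by simp
  also have "\<dots> = (\<Sum>l\<in>{..<M} - K. cnj (u l) * v l)"
    using u' v' eq by (intro sum.cong refl) (metis DiffD1 DiffD2 lessThan_iff)
  finally have out: "(\<Sum>l\<in>{..<M} - K. cnj (u' l) * v' l) = (\<Sum>l\<in>{..<M} - K. cnj (u l) * v l)" .
  have split: "ip M x y = (\<Sum>l\<in>{..<M} - K. cnj (x l) * y l) + (\<Sum>l\<in>K. cnj (x l) * y l)" for x y
    unfolding ip_def by (rule sum.subset_diff) (use K in auto)
  have "(\<Sum>l\<in>K. (cmod (u' l))\<^sup>2) = (\<Sum>l\<in>K. (cmod (u' (\<pi> l)))\<^sup>2)"
    using K(2) injK(1) sum.reindex[of \<pi> K "\<lambda>l. (cmod (u' l))\<^sup>2"] by simp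
  then have mass_u: "(\<Sum>l\<in>K. (cmod (u' l))\<^sup>2) = (\<Sum>l\<in>K. (cmod (u l))\<^sup>2)"
    using u' K(1) by (auto intro!: sum.cong)
  have "(\<Sum>l\<in>K. (cmod (v' l))\<^sup>2) = (\<Sum>l\<in>K. (cmod (v' (\<rho> l)))\<^sup>2)"
    using K(3) injK(2) sum.reindex[of \<rho> K "\<lambda>l. (cmod (v' l))\<^sup>2"] by simp
  then have mass_v: "(\<Sum>l\<in>K. (cmod (v' l))\<^sup>2) = (\<Sum>l\<in>K. (cmod (v l))\<^sup>2)"
    using v' K(1) by (auto intro!: sum.cong)
  have "cmod (ip M u' v' - ip M u v) = cmod ((\<Sum>l\<in>K. cnj (u' l) * v' l) - (\<Sum>l\<in>K. cnj (u l) * v l))"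
    by (simp add: split out)
  also have "\<dots> \<le> cmod (\<Sum>l\<in>K. cnj (u' l) * v' l) + cmod (\<Sum>l\<in>K. cnj (u l) * v l)"
    by (rule norm_triangle_ineq4)
  also have "\<dots> \<le> (\<Sum>l\<in>K. (cmod (u l))\<^sup>2) + (\<Sum>l\<in>K. (cmod (v l))\<^sup>2)"
    using norm_sum_cnj_mult_le[of u' v' K] norm_sum_cnj_mult_le[of u v K] mass_u mass_v by simp
  finally show ?thesis .
qed

text \<open>The weights in the AM-GM inequality below are chosen to make the bound rational; optimal
  ones give \<open>sqrt 3 / 2\<close> instead of \<open>7/8\<close>.\<close>
lemma ip_distinguishable:
  fixes u v :: "nat \<Rightarrow> complex"
  assumes u: "(\<Sum>l<M. (cmod (u l))\<^sup>2) = 1" and v: "(\<Sum>l<M. (cmod (v l))\<^sup>2) = 1"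
    and bad_u: "(\<Sum>l<M. if P l then (cmod (u l))\<^sup>2 else 0) \<le> 1/4"
    and bad_v: "(\<Sum>l<M. if P' l then (cmod (v l))\<^sup>2 else 0) \<le> 1/4"
    and disj: "\<And>l. l < M \<Longrightarrow> P l \<or> P' l"
  shows "Re (ip M u v) \<le> 7/8"
proof -
  let ?p = "\<Sum>l<M. if P l then (cmod (u l))\<^sup>2 else 0"
  let ?q = "\<Sum>l<M. if P l then 0 else (cmod (v l))\<^sup>2"
  \<comment> \<open>Every index outside \<open>P\<close> satisfies \<open>P'\<close>, so
    \<open>v\<close> has little mass there.\<close>
  have "?q \<le> (\<Sum>l<M. if P' l then (cmod (v l))\<^sup>2 else 0)"
    by (rule sum_mono) (use disj in auto)
  then have q: "?q \<le> 1/4" using bad_v by simp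
  \<comment> \<open>The summand is \<open>|u|^2 + |v|^2 / 4\<close> on \<open>P\<close> and
    \<open>|u|^2 / 4 + |v|^2\<close> elsewhere: weight 1 goes to the state whose mass on that part
    is at most 1/4.\<close>
  have "Re (ip M u v) \<le> (\<Sum>l<M. (cmod (u l))\<^sup>2 / 4 + (cmod (v l))\<^sup>2
       + 3/4 * (if P l then (cmod (u l))\<^sup>2 else 0) - 3/4 * (if P l then (cmod (v l))\<^sup>2 else 0))"
    unfolding ip_def Re_sum
  proof (rule sum_mono)
    fix l
    have *: "Re (cnj (u l) * v l) \<le> cmod (u l) * cmod (v l)"
      using complex_Re_le_cmod[of "cnj (u l) * v l"] by (simp add: norm_mult)
    have "0 \<le> (cmod (u l) / 2 - cmod (v l))\<^sup>2" "0 \<le> (cmod (u l) - cmod (v l) / 2)\<^sup>2" by simp_all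
    then show "Re (cnj (u l) * v l) \<le> (cmod (u l))\<^sup>2 / 4 + (cmod (v l))\<^sup>2
       + 3/4 * (if P l then (cmod (u l))\<^sup>2 else 0) - 3/4 * (if P l then (cmod (v l))\<^sup>2 else 0)"
      using * by (auto simp: power2_eq_square algebra_simps)
  qed
  also have "\<dots> = 1/4 + 1 + 3/4 * ?p - 3/4 * (\<Sum>l<M. if P l then (cmod (v l))\<^sup>2 else 0)"
    using u v by (simp add: sum.distrib sum_subtractf sum_divide_distrib[symmetric] sum_distrib_left[symmetric])
  also have "(\<Sum>l<M. if P l then (cmod (v l))\<^sup>2 else 0) = 1 - ?q"
  proof -
    have "(\<Sum>l<M. if P l then (cmod (v l))\<^sup>2 else 0) + ?q = (\<Sum>l<M. (cmod (v l))\<^sup>2)"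
      unfolding sum.distrib[symmetric] by (intro sum.cong) auto
    then show ?thesis using v by simp
  qed
  finally have "Re (ip M u v) \<le> 1/4 + 1 + 3/4 * ?p - 3/4 * (1 - ?q)" .
  moreover have "1/4 + 1 + 3/4 * x - 3/4 * (1 - y) \<le> 7/8" if "x \<le> 1/4" "y \<le> 1/4" for x y :: real
    using that by (simp add: right_diff_distrib)
  ultimately show ?thesis using q bad_u by (meson order_trans)
qed

subsection \<open>Lower bounds from a fooling family\<close>

text \<open>All information at \<open>z\<close> depends on the single bit \<open>cell z\<close>; if
  \<open>cell z\<close> is at least \<open>N\<close>, all members agree there. Derivatives occur in
  \<open>local\<close> for the randomized setting, while quantum queries need only the empty list.
  The solution is recorded only at \<open>b\<close>, as its error there bounds the supremum from
  below.\<close>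

locale fooling_family =
  fixes a b :: real and r q k N :: nat and D ua :: "nat \<Rightarrow> real"
    and g :: "nat set \<Rightarrow> rhs" and cell :: "pt \<Rightarrow> nat" and wt :: "nat \<Rightarrow> real" and w v0 :: real
  assumes a_le_b: "a \<le> b"
    and in_class: "s \<subseteq> {..<N} \<Longrightarrow> g s \<in> Gclass a b r q D"
    and local: "\<lbrakk>z \<in> dom_pts a b q; set ds \<subseteq> {..Suc q}; length ds \<le> r; s \<subseteq> {..<N}; t \<subseteq> {..<N};
        cell z \<in> s \<longleftrightarrow> cell z \<in> t\<rbrakk> \<Longrightarrow> pders a b ds (g s) z = pders a b ds (g t) z"
    and sol: "s \<subseteq> {..<N} \<Longrightarrow> sol a b k q ua (g s) b = v0 + (\<Sum>i\<in>s. wt i)"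
    and wt: "i < N \<Longrightarrow> w \<le> wt i" and w_pos: "0 < w"
begin

section \<open>Randomized algorithms against a uniformly random member of the family\<close>

lemma approx_err_ge: "s \<subseteq> {..<N} \<Longrightarrow>
    ennreal \<bar>v0 + (\<Sum>i\<in>s. wt i) - l b\<bar> \<le> approx_err a b k q ua (g s) l"
  unfolding approx_err_def using a_le_b sol[of s]
  by (intro SUP_upper2[of b]) auto

definition queried :: "dalg \<Rightarrow> nat \<Rightarrow> nat set \<Rightarrow> nat set" where
  "queried A n s = (\<lambda>m. cell (fst (fst A m (info a b (fst A) (g s) m)))) ` {..<n}"

text \<open>Adaptivity does not help: equal answers so far lead to the same next query, whose cell
  differs from \<open>i\<close>, so its answer is equal too.\<close>

lemma info_flip:
  assumes A: "dalg_valid a b r q A" and s: "s \<subseteq> {..<N}" and i: "i < N" "i \<notin> queried A n s"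
  shows "m \<le> n \<Longrightarrow> info a b (fst A) (g (flip i s)) m = info a b (fst A) (g s) m"
proof (induction m)
  case (Suc m)
  let ?y = "info a b (fst A) (g s) m"
  have "cell (fst (fst A m ?y)) \<noteq> i" using i Suc.prems by (auto simp: queried_def)
  then have "pders a b (snd (fst A m ?y)) (g (flip i s)) (fst (fst A m ?y))
      = pders a b (snd (fst A m ?y)) (g s) (fst (fst A m ?y))"
    using A s flip_Pow[OF i(1), of s] by (intro local) (auto simp: dalg_valid_def flip_mem)
  then show ?case using Suc by (simp add: Let_def)
qed simp

text \<open>The output at \<open>b\<close>, shifted by \<open>v0\<close>, is the guess
  \<open>f\<close>; it ignores unqueried bits by \<open>info_flip\<close>. For \<open>n > N\<close>
  the left side is \<open>ennreal\<close> of a negative number, hence 0.\<close>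

lemma sum_dalg_err_sq:
  assumes A: "dalg_valid a b r q A"
  shows "ennreal (2 ^ N * (real N - real n) * w\<^sup>2 / 4)
      \<le> (\<Sum>s\<in>Pow {..<N}. (dalg_err a b k q ua A n (g s))\<^sup>2)"
proof -
  define f where "f s = snd A (info a b (fst A) (g s) n) b - v0" for s
  have "2 ^ N * (real N - real n) * w\<^sup>2 / 4 \<le> (\<Sum>s\<in>Pow {..<N}. ((\<Sum>i\<in>s. wt i) - f s)\<^sup>2)"
  proof (rule sum_squares_unqueried[where Q = "queried A n"])
    fix s i assume *: "s \<subseteq> {..<N}" "i < N" "i \<notin> queried A n s"
    note eq = info_flip[OF A *]
    have "queried A n (flip i s) = queried A n s"
      unfolding queried_def by (intro image_cong refl) (simp add: eq)
    then show "queried A n (flip i s) = queried A n s \<and> f (flip i s) = f s"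
      by (simp add: f_def eq)
  next
    fix s
    have "card ({..<N} \<inter> queried A n s) \<le> card (queried A n s)"
      by (rule card_mono) (auto simp: queried_def)
    also have "\<dots> \<le> n" unfolding queried_def using card_image_le[of "{..<n}"] by auto
    finally show "card ({..<N} \<inter> queried A n s) \<le> n" .
  qed (use wt w_pos in auto)
  then have "ennreal (2 ^ N * (real N - real n) * w\<^sup>2 / 4)
      \<le> ennreal (\<Sum>s\<in>Pow {..<N}. ((\<Sum>i\<in>s. wt i) - f s)\<^sup>2)" by (rule ennreal_leI)
  also have "\<dots> = (\<Sum>s\<in>Pow {..<N}. ennreal (((\<Sum>i\<in>s. wt i) - f s)\<^sup>2))"
    by (simp add: sum_ennreal)
  also have "\<dots> \<le> (\<Sum>s\<in>Pow {..<N}. (dalg_err a b k q ua A n (g s))\<^sup>2)"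
  proof (rule sum_mono)
    fix s assume "s \<in> Pow {..<N}"
    then have "ennreal \<bar>(\<Sum>i\<in>s. wt i) - f s\<bar> \<le> dalg_err a b k q ua A n (g s)"
      using approx_err_ge[of s "snd A (info a b (fst A) (g s) n)"]
      by (simp add: dalg_err_def f_def algebra_simps)
    then have "(ennreal \<bar>(\<Sum>i\<in>s. wt i) - f s\<bar>)\<^sup>2 \<le> (dalg_err a b k q ua A n (g s))\<^sup>2"
      by (rule power_mono) simp
    then show "ennreal (((\<Sum>i\<in>s. wt i) - f s)\<^sup>2) \<le> (dalg_err a b k q ua A n (g s))\<^sup>2"
      by (simp add: ennreal_power)
  qed
  finally show ?thesis .
qed

text \<open>Yao's principle: the worst-case error is at least the average over \<open>s\<close>, and
  exchanging this average with the integral over \<open>M\<close> reduces the claim to deterministic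
  algorithms.\<close>

lemma randomized_lower_bound:
  assumes M: "ralg_valid a b r q k D ua M n"
    and err: "rand_err_sq a b r q k D ua M n \<le> ennreal (\<epsilon>\<^sup>2)"
  shows "(real N - real n) * w\<^sup>2 / 4 \<le> \<epsilon>\<^sup>2"
proof -
  interpret prob_space M using M by (simp add: ralg_valid_def)
  let ?e = "\<lambda>s A. (dalg_err a b k q ua A n (g s))\<^sup>2"
  let ?c = "2 ^ N * (real N - real n) * w\<^sup>2 / 4"
  have "ennreal ?c = (\<integral>\<^sup>+ A. ennreal ?c \<partial>M)" by (simp add: emeasure_space_1)
  also have "\<dots> \<le> (\<integral>\<^sup>+ A. (\<Sum>s\<in>Pow {..<N}. ?e s A) \<partial>M)"
    using sum_dalg_err_sq M by (intro nn_integral_mono) (auto simp: ralg_valid_def)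
  also have "\<dots> = (\<Sum>s\<in>Pow {..<N}. \<integral>\<^sup>+ A. ?e s A \<partial>M)"
    using M in_class by (intro nn_integral_sum borel_measurable_power_ennreal) (auto simp: ralg_valid_def)
  also have "\<dots> \<le> (\<Sum>s\<in>Pow {..<N}. ennreal (\<epsilon>\<^sup>2))"
  proof (rule sum_mono)
    fix s assume "s \<in> Pow {..<N}"
    then have "(\<integral>\<^sup>+ A. ?e s A \<partial>M) \<le> rand_err_sq a b r q k D ua M n"
      unfolding rand_err_sq_def using in_class by (intro SUP_upper) auto
    then show "(\<integral>\<^sup>+ A. ?e s A \<partial>M) \<le> ennreal (\<epsilon>\<^sup>2)" using err by (rule order_trans)
  qed
  also have "\<dots> = ennreal (\<Sum>s\<in>Pow {..<N}. \<epsilon>\<^sup>2)" by (rule sum_ennreal) simp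
  also have "(\<Sum>s\<in>Pow {..<N}. \<epsilon>\<^sup>2) = 2 ^ N * \<epsilon>\<^sup>2" by (simp add: card_Pow)
  finally have "?c \<le> 2 ^ N * \<epsilon>\<^sup>2" by (simp add: ennreal_le_iff)
  then have "2 ^ N * ((real N - real n) * w\<^sup>2 / 4) \<le> 2 ^ N * \<epsilon>\<^sup>2" by (simp add: mult.assoc)
  then show ?thesis by (subst (asm) mult_le_cancel_left_pos) auto
qed

end

subsection \<open>The quantum query as a permutation\<close>

text \<open>The three registers of a basis index are its digits in mixed radix.\<close>

lemma mixed_radix:
  fixes i x y P R :: nat
  assumes "i < P" "x < R"
  shows "(i + P * x + P * R * y) mod P = i"
    and "((i + P * x + P * R * y) div P) mod R = x"
    and "(i + P * x + P * R * y) div (P * R) = y"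
proof -
  have eq: "i + P * x + P * R * y = i + (x + R * y) * P" by (simp add: algebra_simps)
  have "P > 0" "R > 0" using assms by auto
  then show "(i + P * x + P * R * y) mod P = i" "((i + P * x + P * R * y) div P) mod R = x"
      "(i + P * x + P * R * y) div (P * R) = y"
    unfolding eq using assms by (simp_all add: div_mult2_eq)
qed

lemma mixed_radix_decode:
  fixes l P R :: nat
  shows "l mod P + P * ((l div P) mod R) + P * R * (l div (P * R)) = l"
proof -
  have "l mod P + P * ((l div P) mod R) + P * R * (l div (P * R))
      = l mod P + P * ((l div P) mod R + R * (l div P div R))"
    by (simp only: div_mult2_eq distrib_left add.assoc mult.assoc)
  then show ?thesis by (simp only: mod_mult_div_eq)
qed

lemma qperm_mod: "qperm A g l mod 2 ^ qm1 A = l mod 2 ^ qm1 A"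
  using mixed_radix(1)[of "l mod 2 ^ qm1 A" "2 ^ qm1 A" _ "2 ^ qm2 A"]
  by (simp add: qperm_def Let_def power_add)

text \<open>The query fixes the index register and the top register and shifts the middle digit
  modulo \<open>R\<close> by an amount depending on the index register alone. This is injective on a
  finite set.\<close>

lemma qperm_bij:
  assumes "qalg_valid a b q A n"
  shows "bij_betw (qperm A g) {..<2 ^ qm A} {..<2 ^ qm A}"
proof -
  define P R S :: nat where "P = 2 ^ qm1 A" and "R = 2 ^ qm2 A" and "S = 2 ^ (qm A - (qm1 A + qm2 A))"
  have M: "2 ^ qm A = P * R * S"
    using assms by (simp add: P_def R_def S_def qalg_valid_def flip: power_add)
  have pos: "P > 0" "R > 0" by (simp_all add: P_def R_def)
  let ?\<beta> = "\<lambda>l. qbeta A (g (qtau A (l mod P)))"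
  have perm: "qperm A g l = (if l mod P \<in> qZ A
      then l mod P + P * (((l div P) mod R + ?\<beta> l) mod R) + P * R * (l div (P * R)) else l)" for l
    by (simp add: qperm_def Let_def P_def R_def power_add)
  have high: "qperm A g l div (P * R) = l div (P * R)" for l
    using pos by (cases "l mod P \<in> qZ A")
      (simp_all only: perm if_True if_False mixed_radix(3) mod_less_divisor)
  have mid: "(qperm A g l div P) mod R = ((l div P) mod R + ?\<beta> l) mod R" if "l mod P \<in> qZ A" for l
    using pos that by (simp add: perm mixed_radix)
  have low: "qperm A g l mod P = l mod P" for l
    using qperm_mod by (simp add: P_def)
  have "inj_on (qperm A g) {..<2 ^ qm A}"
  proof (rule inj_onI)
    fix l l' assume eq: "qperm A g l = qperm A g l'"
    have lo: "l mod P = l' mod P" and hi: "l div (P * R) = l' div (P * R)"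
      using low high eq by metis+
    show "l = l'"
    proof (cases "l mod P \<in> qZ A")
      case True
      have "((l div P) mod R + ?\<beta> l) mod R = ((l' div P) mod R + ?\<beta> l) mod R"
        using mid[of l] mid[of l'] True lo eq by simp
      \<comment> \<open>Multiples of \<open>R\<close> on both sides express the congruence without
        subtraction, so the shift can be cancelled.\<close>
      then obtain x y where "(l div P) mod R + ?\<beta> l + R * x = (l' div P) mod R + ?\<beta> l + R * y"
        unfolding nat_mod_eq_iff by blast
      then have "((l div P) mod R + R * x) mod R = ((l' div P) mod R + R * y) mod R" by simp
      then have digit: "(l div P) mod R = (l' div P) mod R" by simp
      have "l = l mod P + P * ((l div P) mod R) + P * R * (l div (P * R))"
        by (rule mixed_radix_decode[symmetric])
      also have "\<dots> = l' mod P + P * ((l' div P) mod R) + P * R * (l' div (P * R))"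
        by (simp only: lo hi digit)
      also have "\<dots> = l'" by (rule mixed_radix_decode)
      finally show ?thesis .
    qed (use eq lo in \<open>simp add: perm\<close>)
  qed
  moreover have "qperm A g ` {..<2 ^ qm A} \<subseteq> {..<2 ^ qm A}"
  proof safe
    \<comment> \<open>Only the top register decides whether an index is below
      \<open>P * R * S\<close>.\<close>
    fix l :: nat assume "l < 2 ^ qm A"
    then have "l div (P * R) < S"
      unfolding M using pos by (simp add: less_mult_imp_div_less mult.commute)
    then have "qperm A g l div (P * R) < S" using high by simp
    then show "qperm A g l < 2 ^ qm A"
      unfolding M using pos by (simp add: div_less_iff_less_mult mult.commute)
  qed
  ultimately show ?thesis by (simp add: bij_betw_def endo_inj_surj)
qed

lemma qquery_qperm:
  assumes "qalg_valid a b q A n" "l < 2 ^ qm A"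
  shows "qquery A g v (qperm A g l) = v l"
proof -
  have inj: "inj_on (qperm A g) {..<2 ^ qm A}" using qperm_bij[OF assms(1)] by (simp add: bij_betw_def)
  have "qquery A g v (qperm A g l) = (\<Sum>l'<2 ^ qm A. if l' = l then v l' else 0)"
    unfolding qquery_def using inj_on_eq_iff[OF inj] assms(2) by (intro sum.cong) auto
  then show ?thesis using assms(2) by simp
qed

lemma qstate_norm:
  assumes "qalg_valid a b q A n" "j \<le> n"
  shows "ip (2 ^ qm A) (qstate A g j) (qstate A g j) = 1"
  using assms(2)
proof (induction j)
  case 0
  have "ip (2 ^ qm A) (\<lambda>l. if l = 0 then 1 else 0) (\<lambda>l. if l = 0 then 1 else 0)
      = (\<Sum>l<2 ^ qm A. if l = (0::nat) then 1 else 0)"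
    unfolding ip_def by (intro sum.cong) auto
  then show ?case using assms(1) by (simp add: ip_mat_app qalg_valid_def)
next
  case (Suc j)
  note bij = qperm_bij[OF assms(1), of g]
  \<comment> \<open>With equal permutations the exceptional set can be empty, so the bound is
    0.\<close>
  have "cmod (ip (2 ^ qm A) (qquery A g (qstate A g j)) (qquery A g (qstate A g j))
      - ip (2 ^ qm A) (qstate A g j) (qstate A g j)) \<le> 0"
    using ip_permuted[OF bij bij, where K = "{}" and u' = "qquery A g (qstate A g j)"
        and u = "qstate A g j" and v' = "qquery A g (qstate A g j)" and v = "qstate A g j"]
    by (simp add: qquery_qperm[OF assms(1)])
  then show ?case using Suc assms(1) by (simp add: ip_mat_app qalg_valid_def)
qed

section \<open>Quantum algorithms: the adversary argument\<close>

context fooling_family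
begin

text \<open>Only on these basis states can a query act differently for \<open>s\<close> and
  \<open>flip i s\<close>.\<close>

definition cell_states :: "qalg \<Rightarrow> nat \<Rightarrow> nat set" where
  "cell_states A i = {l. l < 2 ^ qm A \<and> l mod 2 ^ qm1 A \<in> qZ A \<and> cell (qtau A (l mod 2 ^ qm1 A)) = i}"

text \<open>Commonly called the query magnitude of bit \<open>i\<close>.\<close>

definition mass :: "qalg \<Rightarrow> nat set \<Rightarrow> nat \<Rightarrow> nat \<Rightarrow> real" where
  "mass A s j i = (\<Sum>l\<in>cell_states A i. (cmod (qstate A (g s) j l))\<^sup>2)"

definition overlap :: "qalg \<Rightarrow> nat \<Rightarrow> nat set \<Rightarrow> nat \<Rightarrow> real" where
  "overlap A j s i = Re (ip (2 ^ qm A) (qstate A (g s) j) (qstate A (g (flip i s)) j))"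

text \<open>Distinct cells use disjoint basis states of a unit vector. Hence one query can disturb
  all \<open>N\<close> edges at \<open>s\<close> only by a bounded total amount.\<close>

lemma sum_mass_le:
  assumes "qalg_valid a b q A n" "j \<le> n"
  shows "(\<Sum>i<N. mass A s j i) \<le> 1"
proof -
  let ?\<psi> = "\<lambda>l. (cmod (qstate A (g s) j l))\<^sup>2"
  have "(\<Sum>i<N. mass A s j i) = (\<Sum>l\<in>(\<Union>i<N. cell_states A i). ?\<psi> l)"
    unfolding mass_def by (rule sum.UNION_disjoint[symmetric]) (auto simp: cell_states_def)
  also have "\<dots> \<le> (\<Sum>l<2 ^ qm A. ?\<psi> l)"
    by (rule sum_mono2) (auto simp: cell_states_def)
  also have "\<dots> = 1"
    using qstate_norm[OF assms, of "g s"] unfolding ip_self by (simp only: of_real_eq_1_iff)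
  finally show ?thesis .
qed

lemma qperm_cell_states:
  assumes "qalg_valid a b q A n"
  shows "qperm A h ` cell_states A i = cell_states A i"
proof (rule endo_inj_surj)
  have bij: "bij_betw (qperm A h) {..<2 ^ qm A} {..<2 ^ qm A}" by (rule qperm_bij[OF assms])
  show "finite (cell_states A i)" by (simp add: cell_states_def)
  show "inj_on (qperm A h) (cell_states A i)"
    using bij by (auto simp: bij_betw_def cell_states_def intro: inj_on_subset)
  show "qperm A h ` cell_states A i \<subseteq> cell_states A i"
    using bij by (auto simp: cell_states_def qperm_mod dest: bij_betwE)
qed

lemma overlap_step:
  assumes A: "qalg_valid a b q A n" and j: "Suc j \<le> n" and s: "s \<subseteq> {..<N}" and i: "i < N"
  shows "overlap A j s i - overlap A (Suc j) s i \<le> mass A s j i + mass A (flip i s) j i"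
proof -
  let ?M = "2 ^ qm A" and ?u = "qstate A (g s) j" and ?v = "qstate A (g (flip i s)) j"
  let ?qu = "qquery A (g s) ?u" and ?qv = "qquery A (g (flip i s)) ?v"
  have "cmod (ip ?M ?qu ?qv - ip ?M ?u ?v) \<le> mass A s j i + mass A (flip i s) j i"
    unfolding mass_def
  proof (rule ip_permuted[OF qperm_bij[OF A] qperm_bij[OF A]])
    fix l assume l: "l < ?M" "l \<notin> cell_states A i"
    have "g s (qtau A (l mod 2 ^ qm1 A)) = g (flip i s) (qtau A (l mod 2 ^ qm1 A))"
      if "l mod 2 ^ qm1 A \<in> qZ A"
    proof -
      have "cell (qtau A (l mod 2 ^ qm1 A)) \<noteq> i" using l that by (simp add: cell_states_def)
      then show ?thesis
        using local[of "qtau A (l mod 2 ^ qm1 A)" "[]" s "flip i s"] A that s flip_Pow[OF i, of s]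
        by (auto simp: flip_mem qalg_valid_def)
    qed
    then show "qperm A (g s) l = qperm A (g (flip i s)) l" by (simp add: qperm_def Let_def)
  qed (auto simp: qquery_qperm[OF A] qperm_cell_states[OF A], auto simp: cell_states_def)
  then have "Re (ip ?M ?u ?v) - Re (ip ?M ?qu ?qv) \<le> mass A s j i + mass A (flip i s) j i"
    using abs_Re_le_cmod[of "ip ?M ?qu ?qv - ip ?M ?u ?v"] by simp
  moreover have "ip ?M (qstate A (g s) (Suc j)) (qstate A (g (flip i s)) (Suc j)) = ip ?M ?qu ?qv"
    using A j by (simp add: ip_mat_app qalg_valid_def)
  ultimately show ?thesis by (simp add: overlap_def)
qed

text \<open>Reindexing by \<open>flip i\<close> turns the mass at the other end of each edge into
  the mass at \<open>s\<close>, so both mass sums are at most \<open>2 ^ N\<close>.\<close>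

lemma sum_overlap_step:
  assumes A: "qalg_valid a b q A n" and j: "Suc j \<le> n"
  shows "(\<Sum>s\<in>Pow {..<N}. \<Sum>i<N. overlap A j s i) - 2 * 2 ^ N
      \<le> (\<Sum>s\<in>Pow {..<N}. \<Sum>i<N. overlap A (Suc j) s i)"
proof -
  have "(\<Sum>s\<in>Pow {..<N}. \<Sum>i<N. overlap A j s i) - (\<Sum>s\<in>Pow {..<N}. \<Sum>i<N. overlap A (Suc j) s i)
      \<le> (\<Sum>s\<in>Pow {..<N}. \<Sum>i<N. mass A s j i + mass A (flip i s) j i)"
    unfolding sum_subtractf[symmetric] using overlap_step[OF A j] by (intro sum_mono) auto
  also have "\<dots> = (\<Sum>s\<in>Pow {..<N}. \<Sum>i<N. mass A s j i) + (\<Sum>i<N. \<Sum>s\<in>Pow {..<N}. mass A (flip i s) j i)"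
    by (simp add: sum.distrib sum.swap[of _ "{..<N}" "Pow {..<N}"])
  also have "(\<Sum>i<N. \<Sum>s\<in>Pow {..<N}. mass A (flip i s) j i) = (\<Sum>i<N. \<Sum>s\<in>Pow {..<N}. mass A s j i)"
    by (intro sum.cong refl sum_flip[where F = "\<lambda>s. mass A s j _"]) simp
  also have "\<dots> = (\<Sum>s\<in>Pow {..<N}. \<Sum>i<N. mass A s j i)" by (rule sum.swap)
  also have "(\<Sum>s\<in>Pow {..<N}. \<Sum>i<N. mass A s j i) \<le> (\<Sum>s\<in>Pow {..<N}. 1)"
    using sum_mass_le[OF A] j by (intro sum_mono) auto
  finally show ?thesis by (simp add: card_Pow)
qed

text \<open>Before the first query the state does not depend on the right-hand side.\<close>

lemma overlap_initial:
  assumes "qalg_valid a b q A n"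
  shows "overlap A 0 s i = 1"
  using qstate_norm[OF assms, of 0 "g s"] by (simp add: overlap_def)

lemma overlap_final:
  assumes A: "qalg_valid a b q A n" and err: "quant_err a b r q k D ua A n \<le> ennreal \<epsilon>"
    and \<epsilon>: "0 < \<epsilon>" "4 * \<epsilon> \<le> w" and s: "s \<subseteq> {..<N}" and i: "i < N"
  shows "overlap A n s i \<le> 7/8"
proof -
  \<comment> \<open>The infimum in the error need not be attained; the slack from
    \<open>\<epsilon>\<close> to \<open>2 * \<epsilon>\<close> provides an actual threshold.\<close>
  have ex: "\<exists>\<alpha><ennreal (2 * \<epsilon>). qprob_err_gt a b k q ua A n (g t) \<alpha> \<le> 1/4" if "t \<subseteq> {..<N}" for t
  proof -
    have "Inf {\<alpha>. qprob_err_gt a b k q ua A n (g t) \<alpha> \<le> 1/4} \<le> quant_err a b r q k D ua A n"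
      unfolding quant_err_def using in_class[OF that] by (rule SUP_upper)
    also have "\<dots> < ennreal (2 * \<epsilon>)"
      using err \<epsilon>(1) by (auto intro: le_less_trans simp: ennreal_less_iff)
    finally show ?thesis by (auto simp: Inf_less_iff)
  qed
  have t: "flip i s \<subseteq> {..<N}" using flip_Pow[OF i, of s] s by auto
  obtain \<alpha> \<beta> where \<alpha>: "\<alpha> < ennreal (2 * \<epsilon>)" "qprob_err_gt a b k q ua A n (g s) \<alpha> \<le> 1/4"
    and \<beta>: "\<beta> < ennreal (2 * \<epsilon>)" "qprob_err_gt a b k q ua A n (g (flip i s)) \<beta> \<le> 1/4"
    using ex[OF s] ex[OF t] by blast
  have norm: "(\<Sum>l<2 ^ qm A. (cmod (qstate A h n l))\<^sup>2) = 1" for h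
    using qstate_norm[OF A order_refl, of h] unfolding ip_self by (simp only: of_real_eq_1_iff)
  have close: "\<bar>v0 + (\<Sum>i\<in>t. wt i) - qphi A l b\<bar> < 2 * \<epsilon>"
    if "t \<subseteq> {..<N}" "\<gamma> < ennreal (2 * \<epsilon>)" "\<not> approx_err a b k q ua (g t) (qphi A l) > \<gamma>" for t \<gamma> l
  proof -
    have "ennreal \<bar>v0 + (\<Sum>i\<in>t. wt i) - qphi A l b\<bar> < ennreal (2 * \<epsilon>)"
      using approx_err_ge[OF that(1), of "qphi A l"] that(2,3) by (meson le_less_trans not_less)
    then show ?thesis by (simp add: ennreal_less_iff)
  qed
  have sep: "w \<le> \<bar>(\<Sum>i\<in>flip i s. wt i) - (\<Sum>i\<in>s. wt i)\<bar>"
    using sum_flip_weight[of s wt i] wt[OF i] w_pos finite_subset[OF s] by (simp add: sgn_bit_def)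
  show ?thesis
    unfolding overlap_def
  proof (rule ip_distinguishable[OF norm norm])
    show "(\<Sum>l<2 ^ qm A. if approx_err a b k q ua (g s) (qphi A l) > \<alpha>
        then (cmod (qstate A (g s) n l))\<^sup>2 else 0) \<le> 1/4"
      using \<alpha>(2) by (simp add: qprob_err_gt_def)
    show "(\<Sum>l<2 ^ qm A. if approx_err a b k q ua (g (flip i s)) (qphi A l) > \<beta>
        then (cmod (qstate A (g (flip i s)) n l))\<^sup>2 else 0) \<le> 1/4"
      using \<beta>(2) by (simp add: qprob_err_gt_def)
    fix l
    \<comment> \<open>An outcome good for both problems would be within
      \<open>2 * \<epsilon>\<close> of two values at distance at least \<open>w\<close>,
      contradicting \<open>4 * \<epsilon> \<le> w\<close>.\<close>
    show "approx_err a b k q ua (g s) (qphi A l) > \<alpha> \<or> approx_err a b k q ua (g (flip i s)) (qphi A l) > \<beta>"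
      using close[OF s \<alpha>(1), of l] close[OF t \<beta>(1), of l] sep \<epsilon>(2) by linarith
  qed
qed

text \<open>The summed overlap must fall from \<open>N * 2 ^ N\<close> to at most 7/8 of it, at a
  rate of at most \<open>2 * 2 ^ N\<close> per query.\<close>

lemma quantum_lower_bound:
  assumes A: "qalg_valid a b q A n" and err: "quant_err a b r q k D ua A n \<le> ennreal \<epsilon>"
    and \<epsilon>: "0 < \<epsilon>" "4 * \<epsilon> \<le> w"
  shows "N \<le> 16 * n"
proof -
  let ?L = "\<lambda>j. \<Sum>s\<in>Pow {..<N}. \<Sum>i<N. overlap A j s i"
  have "?L 0 - 2 * 2 ^ N * real j \<le> ?L j" if "j \<le> n" for j
    using that
  proof (induction j)
    case (Suc j)
    then show ?case using sum_overlap_step[OF A, of j] by (simp add: algebra_simps)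
  qed simp
  then have "?L 0 - 2 * 2 ^ N * real n \<le> ?L n" by simp
  also have "\<dots> \<le> (\<Sum>s\<in>Pow {..<N}. \<Sum>i<N. 7/8)"
    using overlap_final[OF A err \<epsilon>] by (intro sum_mono) auto
  finally have "2 ^ N * (real N / 8) \<le> 2 ^ N * (2 * real n)"
    using overlap_initial[OF A] by (simp add: card_Pow field_simps)
  then have "real N / 8 \<le> 2 * real n" by (subst (asm) mult_le_cancel_left_pos) auto
  then show ?thesis by linarith
qed

end

subsection \<open>Construction of the fooling family\<close>

text \<open>The constant \<open>c\<close> is chosen before \<open>N\<close> and \<open>ua\<close>,
  which makes the final constants independent of the initial values.\<close>

lemma fooling_family_exists:
  fixes a b :: real and r k q :: nat and D :: "nat \<Rightarrow> real"
  assumes "k \<ge> 1" "a < b" and D: "\<forall>j\<le>r. D j > 0"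
  shows "\<exists>c>0. \<forall>N\<ge>1. \<forall>ua. \<exists>g cell wt v0. fooling_family a b r q k N D ua g cell wt (c / real N ^ Suc r) v0"
proof (rule bump_exists[of r])
  fix \<phi> :: "nat \<Rightarrow> real \<Rightarrow> real" and \<eta> B :: real
  assume
    \<phi>_deriv: "\<And>j t. j < r \<Longrightarrow> (\<phi> j has_real_derivative \<phi> (Suc j) t) (at t)" and
    \<phi>_cont: "\<And>j. j \<le> r \<Longrightarrow> continuous_on UNIV (\<phi> j)" and
    \<phi>_zero: "\<And>j t. t \<notin> {0<..<1} \<Longrightarrow> j \<le> r \<Longrightarrow> \<phi> j t = 0" and
    \<phi>_nonneg: "\<And>t. 0 \<le> \<phi> 0 t" and
    \<phi>_lower: "\<And>t. 1/4 \<le> t \<Longrightarrow> t \<le> 3/4 \<Longrightarrow> \<eta> \<le> \<phi> 0 t" and \<eta>: "\<eta> > 0" and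
    \<phi>_bound: "\<And>j t. j \<le> r \<Longrightarrow> \<bar>\<phi> j t\<bar> \<le> B" and B: "B > 0"
  \<comment> \<open>With this \<open>L\<close>, \<open>N\<close> cells of length
    \<open>1 / (N * L)\<close> exactly fill the left half of the interval.\<close>
  define L where "L = 2 / (b - a)"
  have L: "L > 0" using \<open>a < b\<close> by (simp add: L_def)
  obtain k' where k': "k = Suc k'" using \<open>k \<ge> 1\<close> by (cases k) auto
  \<comment> \<open>This height meets the bounds \<open>D j\<close> for all orders at once.\<close>
  define c1 where "c1 = Min ((\<lambda>j. D j / (L ^ j * B)) ` {..r})"
  have c1: "c1 > 0" unfolding c1_def using D L B by (subst Min_gr_iff) auto
  have c1_le: "c1 * L ^ j * B \<le> D j" if "j \<le> r" for j
  proof -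
    have "c1 \<le> D j / (L ^ j * B)" unfolding c1_def using that by (intro Min_le) auto
    then show ?thesis using L B by (simp add: field_simps)
  qed
  \<comment> \<open>Up to powers of \<open>N\<close>: height \<open>c1 * \<eta>\<close>, times
    \<open>1 / (2 * L)\<close> for the middle half of a cell, times the gain of \<open>k'\<close>
    integrations over the right half.\<close>
  define c where "c = c1 * \<eta> / (2 * L) * ((b - a) / 2) ^ k' / fact k'"
  have "c > 0" using c1 \<eta> L \<open>a < b\<close> by (simp add: c_def)
  moreover have "\<exists>g cell wt v0. fooling_family a b r q k N D ua g cell wt (c / real N ^ Suc r) v0"
    if N: "N \<ge> 1" for N ua
  proof -
    define \<nu> where "\<nu> = real N * L"
    have \<nu>: "\<nu> > 0" using N L by (simp add: \<nu>_def)
    \<comment> \<open>The factor \<open>\<nu> ^ j\<close> comes from the chain rule; dividing by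
      \<open>real N ^ r\<close> keeps it bounded by \<open>L ^ j\<close> for all
      \<open>j \<le> r\<close>.\<close>
    define h where "h i j x = c1 / real N ^ r * \<nu> ^ j * \<phi> j (\<nu> * (x - a) - real i)" for i j x
    define H where "H s j x = (\<Sum>i\<in>s. h i j x)" for s j x
    \<comment> \<open>Cell boundaries may go to either side, since all bumps vanish there.\<close>
    define cl where "cl x = nat \<lfloor>\<nu> * (x - a)\<rfloor>" for x
    have h_deriv: "(h i j has_real_derivative h i (Suc j) x) (at x within {a..b})" if "j < r" for i j x
    proof -
      have "((\<lambda>x. \<phi> j (\<nu> * (x - a) - real i)) has_real_derivative \<phi> (Suc j) (\<nu> * (x - a) - real i) * \<nu>)
          (at x within {a..b})"
        by (rule DERIV_chain2[OF \<phi>_deriv[OF that]]) (auto intro!: derivative_eq_intros)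
      from DERIV_cmult[OF this, of "c1 / real N ^ r * \<nu> ^ j"] show ?thesis
        by (simp add: h_def[abs_def] mult_ac)
    qed
    have h_cont: "continuous_on {a..b} (h i j)" if "j \<le> r" for i j
      unfolding h_def[abs_def]
      by (intro continuous_intros continuous_on_compose2[OF \<phi>_cont[OF that]]) auto
    have h_bound: "\<bar>h i j x\<bar> \<le> D j" if "j \<le> r" for i j x
    proof -
      have "real N ^ j \<le> real N ^ r" using N that by (intro power_increasing) auto
      then have "\<nu> ^ j / real N ^ r \<le> L ^ j"
        using N L by (simp add: \<nu>_def power_mult_distrib field_simps)
      then have "c1 * (\<nu> ^ j / real N ^ r) * \<bar>\<phi> j (\<nu> * (x - a) - real i)\<bar> \<le> c1 * L ^ j * B"
        using c1 L B \<nu> \<phi>_bound[OF that] by (intro mult_mono) auto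
      also have "\<dots> \<le> D j" by (rule c1_le[OF that])
      finally show ?thesis using c1 \<nu> by (simp add: h_def abs_mult)
    qed
    have h_zero: "h i j x = 0" if "j \<le> r" "i \<noteq> cl x" for i j x
    proof -
      have "\<nu> * (x - a) - real i \<notin> {0<..<1}"
      proof
        assume "\<nu> * (x - a) - real i \<in> {0<..<1}"
        then have "\<lfloor>\<nu> * (x - a)\<rfloor> = int i" by (intro floor_unique) auto
        then show False using that by (simp add: cl_def)
      qed
      then show ?thesis using \<phi>_zero that by (simp add: h_def)
    qed
    have H_eq: "H s j x = (if cl x \<in> s then h (cl x) j x else 0)" if "j \<le> r" "s \<subseteq> {..<N}" for s j x
    proof -
      have "finite s" using that finite_subset by blast
      moreover have "H s j x = (\<Sum>i\<in>s. if i = cl x then h (cl x) j x else 0)"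
        unfolding H_def using h_zero[OF that(1)] by (intro sum.cong) auto
      ultimately show ?thesis by simp
    qed
    have H_deriv: "(H s j has_real_derivative H s (Suc j) x) (at x within {a..b})" if "j < r" for s j x
      unfolding H_def[abs_def] using h_deriv[OF that] by (intro DERIV_sum)
    have H_cont: "continuous_on {a..b} (H s j)" if "j \<le> r" for s j
      unfolding H_def[abs_def] using h_cont[OF that] by (intro continuous_on_sum)
    have H_bound: "\<bar>H s j x\<bar> \<le> D j" if "j \<le> r" "s \<subseteq> {..<N}" for s j x
      using H_eq[OF that] h_bound[OF that(1)] D that(1) by (auto intro: less_imp_le)
    \<comment> \<open>Superposition: \<open>E i\<close> is the response to bump \<open>i\<close>
      with zero initial values, and \<open>Z\<close> carries the initial values. This gives the
      weights \<open>E i 0 b\<close> and the offset \<open>Z 0 b\<close>.\<close>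
    have "\<forall>i. \<exists>E. (\<forall>j<k. \<forall>x\<in>{a..b}. (E j has_real_derivative E (Suc j) x) (at x within {a..b}))
        \<and> (\<forall>j<k. E j a = 0) \<and> E k = h i 0"
      using iterated_antiderivative[OF h_cont[of 0], of k "\<lambda>_. 0"] by blast
    then obtain E where
      E_deriv: "\<And>i. \<forall>j<k. \<forall>x\<in>{a..b}. (E i j has_real_derivative E i (Suc j) x) (at x within {a..b})" and
      E_init: "\<And>i. \<forall>j<k. E i j a = 0" and E_top: "\<And>i. E i k = h i 0"
      by metis
    obtain Z where
      Z_deriv: "\<forall>j<k. \<forall>x\<in>{a..b}. (Z j has_real_derivative Z (Suc j) x) (at x within {a..b})" and
      Z_init: "\<forall>j<k. Z j a = ua j" and Z_top: "Z k = (\<lambda>_. 0)"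
      using iterated_antiderivative[of a b "\<lambda>_. 0" k ua] by auto
    have sol_H: "sol a b k q ua (\<lambda>z. H s 0 (z 0)) b = Z 0 b + (\<Sum>i\<in>s. E i 0 b)" for s
    proof (rule sol_x_only[where dd = "\<lambda>j x. Z j x + (\<Sum>i\<in>s. E i j x)"])
      show "\<forall>j<k. \<forall>x\<in>{a..b}. ((\<lambda>x. Z j x + (\<Sum>i\<in>s. E i j x)) has_real_derivative
          Z (Suc j) x + (\<Sum>i\<in>s. E i (Suc j) x)) (at x within {a..b})"
        using Z_deriv E_deriv by (auto intro!: DERIV_add DERIV_sum)
    qed (use \<open>a < b\<close> Z_init E_init Z_top E_top in \<open>auto simp: H_def\<close>)
    have E_lower: "c / real N ^ Suc r \<le> E i 0 b" if "i < N" for i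
    proof -
      define l l' m where "l = a + (real i + 1/4) / \<nu>" and "l' = a + (real i + 3/4) / \<nu>"
        and "m = (a + b) / 2"
      have "c1 / real N ^ r * \<eta> * (l' - l) * (b - m) ^ k' / fact k' \<le> E i 0 b"
      proof (rule iterated_antiderivative_lower[where dd = "E i"])
        show "a \<le> l" "l \<le> l'" "m \<le> b"
          using \<nu> \<open>a < b\<close> by (auto simp: l_def l'_def m_def divide_right_mono)
        have "(real i + 3/4) / \<nu> \<le> real N / \<nu>"
          using \<nu> that by (intro divide_right_mono) auto
        also have "real N / \<nu> = (b - a) / 2" using N \<open>a < b\<close> by (simp add: \<nu>_def L_def)
        finally show "l' \<le> m" by (simp add: l'_def m_def field_simps)
        show "0 \<le> E i (Suc k') x" for x
          using c1 \<nu> \<phi>_nonneg E_top[of i] k' by (simp add: h_def)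
        show "c1 / real N ^ r * \<eta> \<le> E i (Suc k') x" if "x \<in> {l..l'}" for x
        proof -
          have "1/4 \<le> \<nu> * (x - a) - real i" "\<nu> * (x - a) - real i \<le> 3/4"
            using that \<nu> by (auto simp: l_def l'_def field_simps)
          then have "\<eta> \<le> \<phi> 0 (\<nu> * (x - a) - real i)" by (rule \<phi>_lower)
          then show ?thesis using c1 E_top[of i] k' by (simp add: h_def divide_right_mono)
        qed
      qed (use E_deriv E_init k' in auto)
      moreover have "l' - l = 1 / (2 * \<nu>)"
        unfolding l_def l'_def add_diff_cancel_left diff_divide_distrib[symmetric] by simp
      moreover have "b - m = (b - a) / 2" by (simp add: m_def field_simps)
      ultimately show ?thesis by (simp add: c_def \<nu>_def mult_ac)
    qed
    have "fooling_family a b r q k N D ua (\<lambda>s z. H s 0 (z 0)) (\<lambda>z. cl (z 0)) (\<lambda>i. E i 0 b)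
        (c / real N ^ Suc r) (Z 0 b)"
    proof
      show "(\<lambda>z. H s 0 (z 0)) \<in> Gclass a b r q D" if "s \<subseteq> {..<N}" for s
        by (rule x_only_in_Gclass[where F = "H s" and r = r, OF \<open>a < b\<close>])
           (use H_deriv H_cont H_bound that in auto)
      show "pders a b ds (\<lambda>z. H s 0 (z 0)) z = pders a b ds (\<lambda>z. H t 0 (z 0)) z"
        if "z \<in> dom_pts a b q" "set ds \<subseteq> {..Suc q}" "length ds \<le> r" "s \<subseteq> {..<N}" "t \<subseteq> {..<N}"
          "cl (z 0) \<in> s \<longleftrightarrow> cl (z 0) \<in> t" for z ds s t
        using pders_x_only[where F = "H s" and r = r, OF \<open>a < b\<close> H_deriv that(1-3)]
          pders_x_only[where F = "H t" and r = r, OF \<open>a < b\<close> H_deriv that(1-3)]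
          H_eq[OF that(3)] that(4-6) by simp
    qed (use \<open>a < b\<close> sol_H E_lower \<open>c > 0\<close> N in auto)
    then show ?thesis by blast
  qed
  ultimately show ?thesis by blast
qed

section \<open>Choice of N and the final bounds\<close>

lemma nat_scale_exists:
  fixes d \<epsilon> p :: real
  assumes "0 < p" "0 < \<epsilon>" "\<epsilon> \<le> d"
  obtains N :: nat where "N \<ge> 1" "real N powr p \<le> d / \<epsilon>"
    "d powr (1 / p) * (1 / \<epsilon>) powr (1 / p) \<le> 2 * real N"
proof -
  define x where "x = (d / \<epsilon>) powr (1 / p)"
  have x: "x \<ge> 1" using assms by (simp add: x_def ge_one_powr_ge_zero)
  \<comment> \<open>As \<open>x \<ge> 1\<close>, rounding down loses at most a factor 2.\<close>
  define N where "N = nat \<lfloor>x\<rfloor>"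
  have "1 \<le> \<lfloor>x\<rfloor>" using x by simp
  then have N: "N \<ge> 1" "real N \<le> x" "x \<le> 2 * real N"
    unfolding N_def by linarith+
  have "real N powr p \<le> x powr p" using N assms by (intro powr_mono2) auto
  also have "\<dots> = d / \<epsilon>" using assms by (simp add: x_def powr_powr)
  finally show thesis
    using that[of N] N assms by (simp add: x_def powr_mult[symmetric])
qed

theorem theorem1:
  fixes a b :: real and r k q :: nat and D :: "nat \<Rightarrow> real"
  assumes "r \<ge> 1" and "k \<ge> 1" and "q < k" and "a < b"
    and "\<forall>j\<le>r. D j > 0"
  shows "\<exists>C>0. \<exists>\<epsilon>0>0. \<forall>(ua :: nat \<Rightarrow> real) (\<epsilon>::real). 0 < \<epsilon> \<and> \<epsilon> < \<epsilon>0 \<longrightarrow>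
     ereal (C * (1/\<epsilon>) powr (1 / (real r + 1/2))) \<le> comp_rand a b r q k D ua \<epsilon>
   \<and> ereal (C * (1/\<epsilon>) powr (1 / (real r + 1))) \<le> comp_quant a b r q k D ua \<epsilon>"
proof -
  obtain c where c: "c > 0" and family: "\<And>N ua. N \<ge> 1 \<Longrightarrow>
      \<exists>g cell wt v0. fooling_family a b r q k N D ua g cell wt (c / real N ^ Suc r) v0"
    using fooling_family_exists[OF \<open>k \<ge> 1\<close> \<open>a < b\<close> assms(5), where q = q] by metis
  let ?p = "real r + 1/2" and ?p' = "real r + 1"
  \<comment> \<open>The 4 is 2 from rounding times 2 from \<open>N < 2 * n\<close>; the 32 is 2
    times 16 from \<open>N \<le> 16 * n\<close>.\<close>
  define C where "C = min ((c / 3) powr (1 / ?p) / 4) ((c / 4) powr (1 / ?p') / 32)"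
  have "C > 0" using c by (simp add: C_def)
  have rand: "ereal (C * (1/\<epsilon>) powr (1 / ?p)) \<le> comp_rand a b r q k D ua \<epsilon>"
    if \<epsilon>: "0 < \<epsilon>" "\<epsilon> < c / 4" for ua \<epsilon>
    unfolding comp_rand_def
  proof (rule Inf_greatest, safe)
    fix n M assume M: "ralg_valid a b r q k D ua M n" "rand_err_sq a b r q k D ua M n \<le> ennreal (\<epsilon>\<^sup>2)"
    obtain N :: nat where N: "N \<ge> 1" "real N powr ?p \<le> c / 3 / \<epsilon>"
      "(c / 3) powr (1 / ?p) * (1 / \<epsilon>) powr (1 / ?p) \<le> 2 * real N"
      using nat_scale_exists[of ?p \<epsilon> "c / 3"] \<epsilon> c by auto
    obtain g cell wt v0 where "fooling_family a b r q k N D ua g cell wt (c / real N ^ Suc r) v0"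
      using family[OF N(1)] by blast
    then interpret fooling_family a b r q k N D ua g cell wt "c / real N ^ Suc r" v0 .
    have bound: "(real N - real n) * (c / real N ^ Suc r)\<^sup>2 / 4 \<le> \<epsilon>\<^sup>2"
      by (rule randomized_lower_bound[OF M])
    \<comment> \<open>Otherwise half of the bits are unqueried and
      \<open>c^2 / \<epsilon>^2 \<le> 8 * N^(2r+1)\<close>. The choice \<open>c / 3\<close> bounds
      the right side by 8/9 of the left, a contradiction.\<close>
    have "N < 2 * n"
    proof (rule ccontr)
      assume "\<not> N < 2 * n"
      then have "real N / 2 \<le> real N - real n" by linarith
      then have "real N / 2 * (c / real N ^ Suc r)\<^sup>2 \<le> (real N - real n) * (c / real N ^ Suc r)\<^sup>2"
        by (intro mult_right_mono) auto
      then have small: "real N / 2 * (c / real N ^ Suc r)\<^sup>2 / 4 \<le> \<epsilon>\<^sup>2" using bound by linarith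
      have "(real N ^ Suc r)\<^sup>2 = real N * real N ^ (2 * r + 1)"
        by (simp only: power_mult[symmetric] power_Suc[symmetric]) (simp add: mult.commute)
      then have "c\<^sup>2 / (8 * real N ^ (2 * r + 1)) \<le> \<epsilon>\<^sup>2"
        using small N(1) by (simp add: power_divide del: power_Suc)
      moreover have "0 < real N ^ (2 * r + 1)" using N(1) by (intro zero_less_power) simp
      ultimately have "c\<^sup>2 / \<epsilon>\<^sup>2 \<le> 8 * real N ^ (2 * r + 1)"
        using \<epsilon>(1) by (simp add: divide_le_eq mult_ac del: power_Suc)
      also have "real N ^ (2 * r + 1) = real N powr (real (2 * r + 1))"
        using N(1) by (intro powr_realpow[symmetric]) simp
      also have "\<dots> = (real N powr ?p)\<^sup>2"
        unfolding power2_eq_square powr_add[symmetric] by (rule arg_cong[of _ _ "\<lambda>e. real N powr e"]) simp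
      also have "8 * (real N powr ?p)\<^sup>2 \<le> 8 * (c / 3 / \<epsilon>)\<^sup>2"
        using N(2) by (intro mult_left_mono power_mono) auto
      also have "\<dots> = 8/9 * (c\<^sup>2 / \<epsilon>\<^sup>2)" by (simp add: power_divide)
      finally have "c\<^sup>2 / \<epsilon>\<^sup>2 \<le> 0" by linarith
      then show False using c \<epsilon>(1) by (simp add: divide_le_0_iff)
    qed
    moreover have "C * (1/\<epsilon>) powr (1 / ?p) \<le> (c / 3) powr (1 / ?p) / 4 * (1/\<epsilon>) powr (1 / ?p)"
      unfolding C_def by (intro mult_right_mono) auto
    ultimately show "ereal (C * (1/\<epsilon>) powr (1 / ?p)) \<le> ereal (real n)" using N(3) by simp
  qed
  have quant: "ereal (C * (1/\<epsilon>) powr (1 / ?p')) \<le> comp_quant a b r q k D ua \<epsilon>"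
    if \<epsilon>: "0 < \<epsilon>" "\<epsilon> < c / 4" for ua \<epsilon>
    unfolding comp_quant_def
  proof (rule Inf_greatest, safe)
    fix n A assume A: "qalg_valid a b q A n" "quant_err a b r q k D ua A n \<le> ennreal \<epsilon>"
    \<comment> \<open>The choice \<open>c / 4\<close> is what gives
      \<open>4 * \<epsilon> \<le> c / real N ^ Suc r\<close> below.\<close>
    obtain N :: nat where N: "N \<ge> 1" "real N powr ?p' \<le> c / 4 / \<epsilon>"
      "(c / 4) powr (1 / ?p') * (1 / \<epsilon>) powr (1 / ?p') \<le> 2 * real N"
      using nat_scale_exists[of ?p' \<epsilon> "c / 4"] \<epsilon> by auto
    obtain g cell wt v0 where "fooling_family a b r q k N D ua g cell wt (c / real N ^ Suc r) v0"
      using family[OF N(1)] by blast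
    then interpret fooling_family a b r q k N D ua g cell wt "c / real N ^ Suc r" v0 .
    have "real N ^ Suc r \<le> c / 4 / \<epsilon>"
      using N(1,2) powr_realpow[of "real N" "Suc r"] by (simp add: add.commute)
    then have "4 * \<epsilon> \<le> c / real N ^ Suc r" using N(1) \<epsilon>(1) by (simp add: field_simps)
    from quantum_lower_bound[OF A \<epsilon>(1) this] have "N \<le> 16 * n" .
    moreover have "C * (1/\<epsilon>) powr (1 / ?p') \<le> (c / 4) powr (1 / ?p') / 32 * (1/\<epsilon>) powr (1 / ?p')"
      unfolding C_def by (intro mult_right_mono) auto
    ultimately show "ereal (C * (1/\<epsilon>) powr (1 / ?p')) \<le> ereal (real n)" using N(3) by simp
  qed
  show ?thesis
    using rand quant c \<open>C > 0\<close> by (intro exI[of _ C] conjI exI[of _ "c / 4"]) auto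
qed

end
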